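(* Let $D\ge 2$ and $d\ge 2$ be integers, and let $|\Psi\rangle$ be the random tensor-network state with bond dimension $D$ and physical dimension $d$ on a square lattice with volume $V=L\times L$ (periodic boundary conditions), $L\ge 2$. Then the squared norm of $|\Psi\rangle$ is exponentially concentrated around one as $L$ increases: for $\kappa=0.7$, $$\Pr\left(|\langle\Psi|\Psi\rangle-1|\ge\epsilon\right)\le O\left(\frac{\kappa^{L}}{\epsilon^{2}}\right),$$ i.e. there is a constant $C$, independent of $L$ and $\epsilon$, such that for all $L\ge 2$ and $\epsilon>0$ the probability is at most $C\kappa^L/\epsilon^2$.
   Context: Random tensor-network state: the sites are the elements $v=(x,y)$ of $\mathbb{Z}_L\times\mathbb{Z}_L$ (torus, coordinates modulo $L$). To each site attach an independent random unitary $U_v$ on $\mathbb{C}^D\otimes\mathbb{C}^D\otimes\mathbb{C}^d$, distributed according to Haar measure on $U(D^2d)$. Define the site tensor $A^{(v)}_{\alpha,\beta,\gamma,\lambda,j}=\langle\alpha,\beta,0|U_v|\gamma,\lambda,j\rangle$, where $\alpha,\beta,\gamma,\lambda\in\{1,\dots,D\}$ are bond indices, $j\in\{1,\dots,d\}$ is the physical index, and $|0\rangle$ is a fixed unit reference vector of $\mathbb{C}^d$. The index $\gamma$ of site $(x,y)$ is identified with the index $\alpha$ of site $(x,y+1)$, and the index $\lambda$ of site $(x,y)$ with the index $\beta$ of site $(x+1,y)$. The state $|\Psi\rangle\in(\mathbb{C}^d)^{\otimes L^2}$ is $|\Psi\rangle=\sum_{(j_v)}\left(\sum_{\text{bond indices}}\prod_v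 A^{(v)}\right)|(j_v)_v\rangle$. It is not normalized. Probability is with respect to the choice of the unitaries. *)

theory Defs
  imports "HOL-Probability.Probability"
begin

definition cadjoint :: "complex^'n^'m \<Rightarrow> complex^'m^'n" where
  "cadjoint A = (\<chi> i j. cnj (A $ j $ i))"

definition unitary_group :: "(complex^'n^'n) set" where
  "unitary_group = {U. cadjoint U ** U = mat 1 \<and> U ** cadjoint U = mat 1}"

text \<open>
  The Haar measure is characterised as the bi-invariant Borel probability measure on the
  unitary group; existence and uniqueness are classical, but not available in the library.
\<close>

definition haar_unitary :: "(complex^'n^'n) measure \<Rightarrow> bool" where
  "haar_unitary \<mu> \<longleftrightarrow>
     prob_space \<mu> \<and>
     sets \<mu> = sets (restrict_space borel unitary_group) \<and>
     (\<forall>V\<in>unitary_group. distr \<mu> \<mu> (\<lambda>U. V ** U) = \<mu> \<and> distr \<mu> \<mu> (\<lambda>U. U ** V) = \<mu>)"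

definition sites :: "nat \<Rightarrow> (nat \<times> nat) set" where
  "sites L = {..<L} \<times> {..<L}"

text \<open>
  The bond space is \<open>complex^'b\<close> and the physical space \<open>complex^'p\<close>, so that \<open>D = CARD('b)\<close> and
  \<open>d = CARD('p)\<close>. The bra of the reference vector \<open>e\<close> is expanded in the computational basis:
  \<open>site_tensor e U \<alpha> \<beta> \<gamma> \<eta> j\<close> is the matrix element of \<open>U\<close> between the bra of
  \<open>\<alpha> \<otimes> \<beta> \<otimes> e\<close> and the ket of \<open>\<gamma> \<otimes> \<eta> \<otimes> j\<close>.
\<close>

definition site_tensor ::
  "complex^'p::finite \<Rightarrow> complex^('b::finite \<times> 'b \<times> 'p)^('b \<times> 'b \<times> 'p)
     \<Rightarrow> 'b \<Rightarrow> 'b \<Rightarrow> 'b \<Rightarrow> 'b \<Rightarrow> 'p \<Rightarrow> complex" where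
  "site_tensor e U \<alpha> \<beta> \<gamma> \<eta> j =
     (\<Sum>i\<in>UNIV. cnj (e $ i) * U $ (\<alpha>, \<beta>, i) $ (\<gamma>, \<eta>, j))"

text \<open>
  A vector of the \<open>L\<^sup>2\<close>-fold tensor power of \<open>complex^'p\<close> is represented by its coefficients in the
  product basis, indexed by \<open>sites L \<rightarrow>\<^sub>E UNIV\<close>. The bond indices are named by their \<open>\<alpha>\<close> and \<open>\<beta>\<close>
  ends: \<open>a v\<close> and \<open>b v\<close> are the first two indices of site \<open>v\<close>, and the third and fourth
  indices of a site are read off from its two neighbours on the torus.
\<close>

definition tn_state ::
  "nat \<Rightarrow> complex^'p::finite
     \<Rightarrow> (nat \<times> nat \<Rightarrow> complex^('b::finite \<times> 'b \<times> 'p)^('b \<times> 'b \<times> 'p))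
     \<Rightarrow> (nat \<times> nat \<Rightarrow> 'p) \<Rightarrow> complex" where
  "tn_state L e U j =
     (\<Sum>a \<in> sites L \<rightarrow>\<^sub>E UNIV. \<Sum>b \<in> sites L \<rightarrow>\<^sub>E UNIV. \<Prod>(x, y) \<in> sites L.
        site_tensor e (U (x, y))
          (a (x, y)) (b (x, y)) (a (x, (y + 1) mod L)) (b ((x + 1) mod L, y)) (j (x, y)))"

definition tensor_inner ::
  "nat \<Rightarrow> ((nat \<times> nat \<Rightarrow> 'p::finite) \<Rightarrow> complex) \<Rightarrow> ((nat \<times> nat \<Rightarrow> 'p) \<Rightarrow> complex) \<Rightarrow> complex" where
  "tensor_inner L \<Phi> \<Psi> = (\<Sum>j \<in> sites L \<rightarrow>\<^sub>E UNIV. cnj (\<Phi> j) * \<Psi> j)"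

end

theory Submission
  imports Defs
begin

text \<open>
  By Chebyshev it suffices to compute the first two moments of the squared norm. Left invariance of
  the Haar measure under phases, permutations and one plane rotation determines the fourth-order
  moments of a random unitary (Weingarten calculus with the two pairings of two copies). The mean
  is then exactly 1, and the second moment is the partition function of an Ising-like model on the
  torus, with one spin per site (\<open>True\<close> for the swapped pairing) and weights depending on the spin
  of a site and on those of its right and lower neighbours. Unitarity makes the weight of a swapped
  site vanish unless one of these two neighbours is swapped, so the all-identity configuration
  contributes 1, and every other contributing configuration has a swapped spin on each of the \<open>L\<close>
  diagonals; a transfer matrix estimate from diagonal to diagonal bounds their total weight by a
  multiple of \<open>(625/1024)^L\<close>.
\<close>

section \<open>Tensor networks\<close>

text \<open>The obstacle is to make the contraction per diagonal beat the number of diagonal states.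
  A diagonal with few swapped spins is contracted only by the constant 25/64. If this uniform factor
  were charged at every step, the sum over the 2^L starting diagonals would give (25/32)^L, which is
  larger than 0.7^L. A diagonal with k swapped spins is however also contracted by (9/16)^k, and
  summing this over all diagonals gives (1 + 9/16)^L = (25/16)^L. Charging the second factor once
  and the first one L - 1 times leads to the base 25/64 * 25/16 = 625/1024. The contraction is
  visible only after reweighting: each swapped spin gets the weight 4 = 2 * 2, whose share 2 stays
  rational. The bounds 5/4 and 9/4 on the reweighted site sums have to cover D = d = 2, where the
  exact values are 78/63 and 132/63.\<close>

lemma sum_PiE_Times:
  fixes F :: "('v \<Rightarrow> 'a::finite) \<Rightarrow> ('v \<Rightarrow> 'b::finite) \<Rightarrow> 'c::comm_monoid_add"
  shows "(\<Sum>a\<in>S \<rightarrow>\<^sub>E UNIV. \<Sum>b\<in>S \<rightarrow>\<^sub>E UNIV. F a b) =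
    (\<Sum>c\<in>S \<rightarrow>\<^sub>E UNIV. F (restrict (fst \<circ> c) S) (restrict (snd \<circ> c) S))"
  unfolding sum.cartesian_product
  by (rule sum.reindex_bij_witness
        [where j = "\<lambda>(a, b). restrict (\<lambda>v. (a v, b v)) S"
           and i = "\<lambda>c. (restrict (fst \<circ> c) S, restrict (snd \<circ> c) S)"])
     (auto simp: fun_eq_iff PiE_def extensional_def restrict_def split: if_splits
       intro!: arg_cong2[where f = F])

lemma sum_PiE_reindex:
  fixes F :: "('v \<Rightarrow> 'a::finite) \<Rightarrow> 'c::comm_monoid_add"
  assumes "bij_betw r S S"
  shows "(\<Sum>a\<in>S \<rightarrow>\<^sub>E UNIV. F (restrict (a \<circ> r) S)) = (\<Sum>a\<in>S \<rightarrow>\<^sub>E UNIV. F a)"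
proof -
  define q where "q = the_inv_into S r"
  have q: "q v \<in> S" "r (q v) = v" "q (r v) = v" "r v \<in> S" if "v \<in> S" for v
    using assms that unfolding q_def
    by (auto simp: bij_betw_def f_the_inv_into_f the_inv_into_f_f intro!: the_inv_into_into)
  show ?thesis
    by (rule sum.reindex_bij_witness
          [where j = "\<lambda>a. restrict (a \<circ> r) S" and i = "\<lambda>a. restrict (a \<circ> q) S"])
       (auto simp: fun_eq_iff PiE_def extensional_def restrict_def q)
qed

text \<open>The index type is arbitrary, so that the state, its squared norm (pairs of bond indices)
  and the square of that (pairs of pairs) are networks on the same torus. The maps \<open>r\<close>
  and \<open>d\<close> lead to the two neighbours whose first and second indices serve as third and
  fourth index of a site.\<close>

definition tnet ::
  "'v set \<Rightarrow> ('v \<Rightarrow> 'v) \<Rightarrow> ('v \<Rightarrow> 'v) \<Rightarrow>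
     ('v \<Rightarrow> 'i::finite \<Rightarrow> 'i \<Rightarrow> 'i \<Rightarrow> 'i \<Rightarrow> 'c::comm_semiring_1) \<Rightarrow> 'c" where
  "tnet S r d w = (\<Sum>a\<in>S \<rightarrow>\<^sub>E UNIV. \<Sum>b\<in>S \<rightarrow>\<^sub>E UNIV.
     \<Prod>v\<in>S. w v (a v) (b v) (a (r v)) (b (d v)))"

lemma tnet_cong:
  assumes "\<And>v a b c e. v \<in> S \<Longrightarrow> w v a b c e = w' v a b c e"
  shows "tnet S r d w = tnet S r d w'"
  unfolding tnet_def using assms by (intro sum.cong prod.cong) auto

lemma cnj_tnet: "cnj (tnet S r d w) = tnet S r d (\<lambda>v a b c e. cnj (w v a b c e))"
  unfolding tnet_def by (simp add: cnj_sum cnj_prod)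

text \<open>Bond indices of the two factors are merged into pairs. It is used for bra and ket, and
  again for the two copies of the squared norm.\<close>

lemma tnet_mult:
  fixes w :: "'v \<Rightarrow> 'i::finite \<Rightarrow> 'i \<Rightarrow> 'i \<Rightarrow> 'i \<Rightarrow> 'c::comm_semiring_1"
    and w' :: "'v \<Rightarrow> 'j::finite \<Rightarrow> 'j \<Rightarrow> 'j \<Rightarrow> 'j \<Rightarrow> 'c"
  assumes "r ` S \<subseteq> S" "d ` S \<subseteq> S"
  shows "tnet S r d w * tnet S r d w' =
    tnet S r d (\<lambda>v a b c e. w v (fst a) (fst b) (fst c) (fst e) * w' v (snd a) (snd b) (snd c) (snd e))"
    (is "_ = ?rhs")
proof -
  have "tnet S r d w * tnet S r d w' =
    (\<Sum>a\<in>S \<rightarrow>\<^sub>E UNIV. \<Sum>a'\<in>S \<rightarrow>\<^sub>E UNIV. \<Sum>b\<in>S \<rightarrow>\<^sub>E UNIV. \<Sum>b'\<in>S \<rightarrow>\<^sub>E UNIV.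
      (\<Prod>v\<in>S. w v (a v) (b v) (a (r v)) (b (d v))) * (\<Prod>v\<in>S. w' v (a' v) (b' v) (a' (r v)) (b' (d v))))"
    unfolding tnet_def sum_product ..
  also have "\<dots> = (\<Sum>c\<in>S \<rightarrow>\<^sub>E UNIV. \<Sum>b\<in>S \<rightarrow>\<^sub>E UNIV. \<Sum>b'\<in>S \<rightarrow>\<^sub>E UNIV.
      (\<Prod>v\<in>S. w v (restrict (fst \<circ> c) S v) (b v) (restrict (fst \<circ> c) S (r v)) (b (d v))) *
      (\<Prod>v\<in>S. w' v (restrict (snd \<circ> c) S v) (b' v) (restrict (snd \<circ> c) S (r v)) (b' (d v))))"
    by (rule sum_PiE_Times)
  also have "\<dots> = (\<Sum>c\<in>S \<rightarrow>\<^sub>E UNIV. \<Sum>c'\<in>S \<rightarrow>\<^sub>E UNIV.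
      (\<Prod>v\<in>S. w v (restrict (fst \<circ> c) S v) (restrict (fst \<circ> c') S v)
        (restrict (fst \<circ> c) S (r v)) (restrict (fst \<circ> c') S (d v))) *
      (\<Prod>v\<in>S. w' v (restrict (snd \<circ> c) S v) (restrict (snd \<circ> c') S v)
        (restrict (snd \<circ> c) S (r v)) (restrict (snd \<circ> c') S (d v))))"
    by (intro sum.cong refl) (rule sum_PiE_Times)
  also have "\<dots> = ?rhs"
    unfolding tnet_def prod.distrib[symmetric]
  proof (intro sum.cong prod.cong refl)
    fix v assume "v \<in> S"
    then have "r v \<in> S" "d v \<in> S" using assms by auto
    with \<open>v \<in> S\<close> show "w v (restrict (fst \<circ> c) S v) (restrict (fst \<circ> c') S v)
         (restrict (fst \<circ> c) S (r v)) (restrict (fst \<circ> c') S (d v)) *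
        w' v (restrict (snd \<circ> c) S v) (restrict (snd \<circ> c') S v)
         (restrict (snd \<circ> c) S (r v)) (restrict (snd \<circ> c') S (d v)) =
       w v (fst (c v)) (fst (c' v)) (fst (c (r v))) (fst (c' (d v))) *
       w' v (snd (c v)) (snd (c' v)) (snd (c (r v))) (snd (c' (d v)))" for c c'
      by simp
  qed
  finally show ?thesis .
qed

text \<open>A label that occurs at one site only can be summed site by site. The labels are the
  physical indices in the norm, and the spins in \<open>tnet_spin_sum\<close>.\<close>

lemma sum_tnet:
  fixes w :: "'v \<Rightarrow> 'p::finite \<Rightarrow> 'i::finite \<Rightarrow> 'i \<Rightarrow> 'i \<Rightarrow> 'i \<Rightarrow> 'c::comm_semiring_1"
  assumes "finite S"
  shows "(\<Sum>j\<in>S \<rightarrow>\<^sub>E UNIV. tnet S r d (\<lambda>v. w v (j v))) =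
    tnet S r d (\<lambda>v a b c e. \<Sum>j\<in>UNIV. w v j a b c e)"
proof -
  have "(\<Sum>j\<in>S \<rightarrow>\<^sub>E UNIV. tnet S r d (\<lambda>v. w v (j v))) =
    (\<Sum>a\<in>S \<rightarrow>\<^sub>E UNIV. \<Sum>b\<in>S \<rightarrow>\<^sub>E UNIV. \<Sum>j\<in>S \<rightarrow>\<^sub>E UNIV.
      \<Prod>v\<in>S. w v (j v) (a v) (b v) (a (r v)) (b (d v)))"
    unfolding tnet_def
    by (rule trans[OF sum.swap], intro sum.cong refl, rule sum.swap)
  then show ?thesis
    unfolding tnet_def using assms by (simp add: prod_sum_PiE)
qed

text \<open>Passes from bond indices to spins. For fixed spins, the index of the bond from
  \<open>v\<close> to \<open>r v\<close> occurs only in \<open>p\<close> at \<open>r v\<close> and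
  in \<open>K\<close> at \<open>v\<close>. Moving the factor \<open>p\<close> back to
  \<open>v\<close>, and \<open>q\<close> likewise along \<open>d\<close>, decouples all bond sums;
  the price is that a site now sees the spins of its two neighbours.\<close>

lemma tnet_spin_sum:
  fixes S :: "'v set" and p q :: "'s::finite \<Rightarrow> 'i::finite \<Rightarrow> 'c::comm_semiring_1"
  assumes fin: "finite S" and r: "bij_betw r S S" and d: "bij_betw d S S"
  shows "tnet S r d (\<lambda>v a b c e. \<Sum>s\<in>UNIV. p s a * q s b * K s c e) =
    (\<Sum>\<sigma>\<in>S \<rightarrow>\<^sub>E UNIV. \<Prod>v\<in>S. \<Sum>c\<in>UNIV. \<Sum>e\<in>UNIV. p (\<sigma> (r v)) c * q (\<sigma> (d v)) e * K (\<sigma> v) c e)"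
proof -
  have "tnet S r d (\<lambda>v a b c e. \<Sum>s\<in>UNIV. p s a * q s b * K s c e) =
    (\<Sum>\<sigma>\<in>S \<rightarrow>\<^sub>E UNIV. tnet S r d (\<lambda>v a b c e. p (\<sigma> v) a * q (\<sigma> v) b * K (\<sigma> v) c e))"
    using sum_tnet[OF fin, of r d "\<lambda>v s a b c e. p s a * q s b * K s c e"] by simp
  also have "\<dots> = (\<Sum>\<sigma>\<in>S \<rightarrow>\<^sub>E UNIV. \<Prod>v\<in>S. \<Sum>c\<in>UNIV. \<Sum>e\<in>UNIV.
    p (\<sigma> (r v)) c * q (\<sigma> (d v)) e * K (\<sigma> v) c e)"
  proof (intro sum.cong refl)
    fix \<sigma> :: "'v \<Rightarrow> 's"
    have "(\<Prod>v\<in>S. p (\<sigma> v) (a v) * q (\<sigma> v) (b v) * K (\<sigma> v) (a (r v)) (b (d v))) =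
      (\<Prod>v\<in>S. p (\<sigma> (r v)) (a (r v)) * q (\<sigma> (d v)) (b (d v)) * K (\<sigma> v) (a (r v)) (b (d v)))"
      for a b :: "'v \<Rightarrow> 'i"
      using prod.reindex_bij_betw[OF r, of "\<lambda>v. p (\<sigma> v) (a v)"]
        prod.reindex_bij_betw[OF d, of "\<lambda>v. q (\<sigma> v) (b v)"]
      by (simp add: prod.distrib)
    then have "tnet S r d (\<lambda>v a b c e. p (\<sigma> v) a * q (\<sigma> v) b * K (\<sigma> v) c e) =
      (\<Sum>a\<in>S \<rightarrow>\<^sub>E UNIV. \<Sum>b\<in>S \<rightarrow>\<^sub>E UNIV. \<Prod>v\<in>S.
        p (\<sigma> (r v)) (restrict (a \<circ> r) S v) * q (\<sigma> (d v)) (restrict (b \<circ> d) S v)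
          * K (\<sigma> v) (restrict (a \<circ> r) S v) (restrict (b \<circ> d) S v))"
      unfolding tnet_def by (intro sum.cong refl) simp
    also have "\<dots> = (\<Sum>a\<in>S \<rightarrow>\<^sub>E UNIV. \<Sum>b\<in>S \<rightarrow>\<^sub>E UNIV. \<Prod>v\<in>S.
        p (\<sigma> (r v)) (a v) * q (\<sigma> (d v)) (b v) * K (\<sigma> v) (a v) (b v))"
      by (rule trans[OF sum_PiE_reindex[OF r, where F = "\<lambda>a. \<Sum>b\<in>S \<rightarrow>\<^sub>E UNIV. \<Prod>v\<in>S.
        p (\<sigma> (r v)) (a v) * q (\<sigma> (d v)) (restrict (b \<circ> d) S v) * K (\<sigma> v) (a v) (restrict (b \<circ> d) S v)"]],
        rule sum.cong[OF refl], rule sum_PiE_reindex[OF d])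
    also have "\<dots> = (\<Prod>v\<in>S. \<Sum>c\<in>UNIV. \<Sum>e\<in>UNIV.
        p (\<sigma> (r v)) c * q (\<sigma> (d v)) e * K (\<sigma> v) c e)"
      using fin by (simp add: prod_sum_PiE)
    finally show "tnet S r d (\<lambda>v a b c e. p (\<sigma> v) a * q (\<sigma> v) b * K (\<sigma> v) c e) = \<dots>" .
  qed
  finally show ?thesis .
qed

lemma integral_tnet:
  fixes w :: "'u \<Rightarrow> 'i::finite \<Rightarrow> 'i \<Rightarrow> 'i \<Rightarrow> 'i \<Rightarrow> complex"
  assumes "prob_space \<mu>" and fin: "finite S"
    and int: "\<And>a b c e. integrable \<mu> (\<lambda>U. w U a b c e)"
  shows integrable_tnet: "integrable (\<Pi>\<^sub>M v\<in>S. \<mu>) (\<lambda>U. tnet S r d (\<lambda>v. w (U v)))"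
    and "(\<integral>U. tnet S r d (\<lambda>v. w (U v)) \<partial>(\<Pi>\<^sub>M v\<in>S. \<mu>)) =
      tnet S r d (\<lambda>v a b c e. \<integral>U. w U a b c e \<partial>\<mu>)"
proof -
  interpret prob_space \<mu> by fact
  interpret product_sigma_finite "\<lambda>_. \<mu>" by unfold_locales
  have *: "integrable (\<Pi>\<^sub>M v\<in>S. \<mu>) (\<lambda>U. \<Prod>v\<in>S. w (U v) (a v) (b v) (a (r v)) (b (d v)))" for a b
    by (rule product_integrable_prod[OF fin, of "\<lambda>v U. w U (a v) (b v) (a (r v)) (b (d v))"]) (rule int)
  then show "integrable (\<Pi>\<^sub>M v\<in>S. \<mu>) (\<lambda>U. tnet S r d (\<lambda>v. w (U v)))"
    unfolding tnet_def by (intro Bochner_Integration.integrable_sum)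
  have "(\<integral>U. (\<Prod>v\<in>S. w (U v) (a v) (b v) (a (r v)) (b (d v))) \<partial>(\<Pi>\<^sub>M v\<in>S. \<mu>)) =
    (\<Prod>v\<in>S. \<integral>U. w U (a v) (b v) (a (r v)) (b (d v)) \<partial>\<mu>)" for a b
    by (rule product_integral_prod[OF fin, of "\<lambda>v U. w U (a v) (b v) (a (r v)) (b (d v))"]) (rule int)
  with * show "(\<integral>U. tnet S r d (\<lambda>v. w (U v)) \<partial>(\<Pi>\<^sub>M v\<in>S. \<mu>)) =
      tnet S r d (\<lambda>v a b c e. \<integral>U. w U a b c e \<partial>\<mu>)"
    unfolding tnet_def by simp
qed

section \<open>The spin model on the torus\<close>

lemma sum_PiE_lessThan_Suc:
  fixes F :: "(nat \<Rightarrow> 'a) \<Rightarrow> 'c::comm_monoid_add"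
  shows "(\<Sum>u\<in>{..<Suc n} \<rightarrow>\<^sub>E B. F u) = (\<Sum>u\<in>{..<n} \<rightarrow>\<^sub>E B. \<Sum>x\<in>B. F (u(n := x)))"
  unfolding sum.cartesian_product
  by (rule sum.reindex_bij_witness
        [where j = "\<lambda>u. (restrict u {..<n}, u n)" and i = "\<lambda>(u, x). u(n := x)"])
     (auto simp: fun_eq_iff PiE_def extensional_def restrict_def Pi_def less_Suc_eq
       intro!: arg_cong[where f = F])

text \<open>Bounds the trace of a power of a nonnegative matrix after conjugation by
  \<open>h\<close>. Two bounds on the same column sums are kept: \<open>\<eta>\<close> is uniform
  and pays for all edges but one, while \<open>c\<close> may decay with the state and pays for the
  remaining edge, which keeps the sum over starting states small.\<close>

lemma closed_path_sum_le:
  fixes T :: "'a \<Rightarrow> 'a \<Rightarrow> real" and h c :: "'a \<Rightarrow> real"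
  assumes fin: "finite B"
    and T: "\<And>x y. x \<in> B \<Longrightarrow> y \<in> B \<Longrightarrow> 0 \<le> T x y"
    and h: "\<And>x. x \<in> B \<Longrightarrow> 0 < h x"
    and \<eta>: "\<And>y. y \<in> B \<Longrightarrow> (\<Sum>x\<in>B. h x * T x y) \<le> \<eta> * h y" "0 \<le> \<eta>"
    and c: "\<And>y. y \<in> B \<Longrightarrow> (\<Sum>x\<in>B. h x * T x y) \<le> c y * h y"
    and L: "2 \<le> L"
  shows "(\<Sum>u\<in>{..<L} \<rightarrow>\<^sub>E B. \<Prod>t<L. T (u (Suc t mod L)) (u t)) \<le> \<eta> ^ (L - 1) * (\<Sum>y\<in>B. c y)"
proof -
  obtain n where n: "L = Suc n" "n \<ge> 1" using L by (cases L) auto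
  \<comment> \<open>Open paths with \<open>m\<close> edges. The conjugating factors telescope,
    leaving only the ratio of \<open>h\<close> at the two ends.\<close>
  define P where "P m = (\<Sum>u\<in>{..<Suc m} \<rightarrow>\<^sub>E B. (\<Prod>t<m. T (u (Suc t)) (u t)) * (h (u m) / h (u 0)))" for m
  have mem: "u t \<in> B" if "u \<in> {..<Suc m} \<rightarrow>\<^sub>E B" "t \<le> m" for u :: "nat \<Rightarrow> 'a" and m t
    using that by (auto simp: PiE_def Pi_def)
  have nonneg: "0 \<le> (\<Prod>t<m. T (u (Suc t)) (u t))" if "u \<in> {..<Suc m} \<rightarrow>\<^sub>E B" for u m
    using that by (intro prod_nonneg ballI T) (auto intro: mem)
  have P_Suc: "P (Suc m) = (\<Sum>u\<in>{..<Suc m} \<rightarrow>\<^sub>E B.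
      (\<Prod>t<m. T (u (Suc t)) (u t)) * ((\<Sum>x\<in>B. h x * T x (u m)) / h (u 0)))" for m
  proof -
    have "P (Suc m) = (\<Sum>u\<in>{..<Suc m} \<rightarrow>\<^sub>E B. \<Sum>x\<in>B.
      (\<Prod>t<m. T (u (Suc t)) (u t)) * (h x * T x (u m) / h (u 0)))"
      unfolding P_def sum_PiE_lessThan_Suc[of _ "Suc m"] by (simp add: mult_ac)
    then show ?thesis
      by (simp add: sum_distrib_left sum_divide_distrib)
  qed
  have P_step: "P (Suc m) \<le> \<eta> * P m" for m
  proof -
    have "P (Suc m) \<le> (\<Sum>u\<in>{..<Suc m} \<rightarrow>\<^sub>E B.
      (\<Prod>t<m. T (u (Suc t)) (u t)) * (\<eta> * h (u m) / h (u 0)))"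
      unfolding P_Suc
    proof (intro sum_mono mult_left_mono divide_right_mono \<eta> nonneg)
      fix u assume "u \<in> {..<Suc m} \<rightarrow>\<^sub>E B"
      then have "u m \<in> B" "u 0 \<in> B" by (auto intro: mem)
      then show "u m \<in> B" "0 \<le> h (u 0)" using h by (auto intro: less_imp_le)
    qed
    also have "\<dots> = \<eta> * P m"
      unfolding P_def by (simp add: sum_distrib_left mult_ac)
    finally show ?thesis .
  qed
  have P1: "P 1 \<le> (\<Sum>y\<in>B. c y)"
  proof -
    have "P 1 = (\<Sum>y\<in>B. (\<Sum>x\<in>B. h x * T x y) / h y)"
      using P_Suc[of 0] sum_PiE_lessThan_Suc[where n = 0 and B = B and F = "\<lambda>u. (\<Sum>x\<in>B. h x * T x (u 0)) / h (u 0)"]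
      by simp
    also have "\<dots> \<le> (\<Sum>y\<in>B. c y)"
      using c h by (intro sum_mono) (simp add: pos_divide_le_eq)
    finally show ?thesis .
  qed
  have P_le: "P (Suc m) \<le> \<eta> ^ m * (\<Sum>y\<in>B. c y)" for m
  proof (induction m)
    case 0
    show ?case using P1 by simp
  next
    case (Suc m)
    have "P (Suc (Suc m)) \<le> \<eta> * P (Suc m)" by (rule P_step)
    also have "\<dots> \<le> \<eta> * (\<eta> ^ m * (\<Sum>y\<in>B. c y))"
      using Suc \<eta>(2) by (rule mult_left_mono)
    finally show ?case by (simp add: mult_ac)
  qed
  have "(\<Sum>u\<in>{..<Suc n} \<rightarrow>\<^sub>E B. \<Prod>t<Suc n. T (u (Suc t mod Suc n)) (u t)) \<le> \<eta> * P n"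
    unfolding P_def sum_distrib_left
  proof (intro sum_mono)
    fix u assume u: "u \<in> {..<Suc n} \<rightarrow>\<^sub>E B"
    then have B: "u n \<in> B" "u 0 \<in> B" by (auto intro: mem)
    \<comment> \<open>The closing edge is a single term of a nonnegative column sum, and its bound
      supplies precisely the end ratio in \<open>P n\<close>.\<close>
    have "h (u 0) * T (u 0) (u n) \<le> (\<Sum>x\<in>B. h x * T x (u n))"
      using fin B T less_imp_le[OF h] by (intro member_le_sum) (auto intro!: mult_nonneg_nonneg)
    also have "\<dots> \<le> \<eta> * h (u n)" using B by (intro \<eta>)
    finally have "T (u 0) (u n) \<le> \<eta> * (h (u n) / h (u 0))"
      using h[OF B(2)] by (simp add: field_simps)
    then have "(\<Prod>t<n. T (u (Suc t)) (u t)) * T (u 0) (u n) \<le>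
      (\<Prod>t<n. T (u (Suc t)) (u t)) * (\<eta> * (h (u n) / h (u 0)))"
      using nonneg[OF u] by (rule mult_left_mono)
    then show "(\<Prod>t<Suc n. T (u (Suc t mod Suc n)) (u t)) \<le>
      \<eta> * ((\<Prod>t<n. T (u (Suc t)) (u t)) * (h (u n) / h (u 0)))"
      by (simp add: mult_ac)
  qed
  also have "\<dots> \<le> \<eta> ^ n * (\<Sum>y\<in>B. c y)"
    using P_le[of "n - 1"] n \<eta>(2) by (cases n) (auto simp: mult.assoc intro: mult_left_mono)
  finally show ?thesis unfolding n(1) by simp
qed

lemma cyclic_induct:
  assumes step: "\<And>x. x < L \<Longrightarrow> P x \<Longrightarrow> P (Suc x mod L)"
    and "x < L" "P x" "y < L"
  shows "P y"
proof -
  have *: "P ((x + k) mod L)" for k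
  proof (induction k)
    case (Suc k)
    have "P (Suc ((x + k) mod L) mod L)" using Suc \<open>x < L\<close> by (intro step) auto
    then show ?case by (simp add: mod_Suc_eq)
  qed (use assms in simp)
  \<comment> \<open>Up to a full turn this is the number of steps from \<open>x\<close> to
    \<open>y\<close>; adding \<open>L\<close> first keeps the subtraction from truncating.\<close>
  from *[of "y + L - x"] assms show ?thesis by simp
qed

lemma bij_betw_Suc_mod: "bij_betw (\<lambda>x. Suc x mod L) {..<L} {..<L}"
proof (cases "L = 0")
  case False
  have "inj_on (\<lambda>x. Suc x mod L) {..<L}"
    by (rule inj_onI) (auto simp: mod_Suc split: if_splits)
  moreover have "(\<lambda>x. Suc x mod L) ` {..<L} \<subseteq> {..<L}" using False by auto
  ultimately show ?thesis
    by (simp add: bij_betw_def endo_inj_surj)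
qed simp

lemma prod_le_two_factors:
  fixes f :: "'a \<Rightarrow> real"
  assumes "finite S" "x \<in> S" "y \<in> S" "x \<noteq> y" "f x \<le> m" "f y \<le> m"
    and f: "\<And>z. z \<in> S \<Longrightarrow> 0 \<le> f z" "\<And>z. z \<in> S \<Longrightarrow> f z \<le> 1"
  shows "prod f S \<le> m\<^sup>2"
proof -
  have "0 \<le> m" using f(1)[OF assms(2)] assms(5) by linarith
  have "prod f S = f x * (f y * prod f (S - {x} - {y}))"
    using assms by (simp add: prod.remove[of S x] prod.remove[of "S - {x}" y])
  also have "\<dots> \<le> m * (m * 1)"
    using assms(1-6) \<open>0 \<le> m\<close> f
    by (intro mult_mono prod_le_1) (auto intro!: prod_nonneg mult_nonneg_nonneg)
  finally show ?thesis by (simp add: power2_eq_square)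
qed

text \<open>
  Read towards increasing \<open>t\<close>, the model is a transfer process on the diagonals
  \<open>x + y = - t\<close> of the torus: each spin depends on two adjacent spins of the previous diagonal,
  and the diagonal with only \<open>False\<close> spins is absorbing. Each \<open>True\<close> spin gets the weight 4, which
  is spread evenly over the two spins of the next diagonal that depend on it.
\<close>

locale spin_model =
  fixes w :: "bool \<Rightarrow> bool \<Rightarrow> bool \<Rightarrow> real" and L :: nat
  assumes nonneg: "0 \<le> w s b c"
    and absorbing: "w False False False = 1" "w True False False = 0"
    and mixed: "b \<noteq> c \<Longrightarrow> w False b c + 4 * w True b c \<le> 5 / 4"
    and both: "w False True True + 4 * w True True True \<le> 9 / 4"
    and L: "2 \<le> L"
begin

definition diag_weight :: "(nat \<Rightarrow> bool) \<Rightarrow> (nat \<Rightarrow> bool) \<Rightarrow> real" where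
  "diag_weight A B = (\<Prod>x<L. w (A x) (B x) (B (Suc x mod L)))"

definition height :: "(nat \<Rightarrow> bool) \<Rightarrow> real" where
  "height B = (\<Prod>x<L. if B x then 4 else 1)"

definition ratio :: "bool \<Rightarrow> bool \<Rightarrow> real" where
  "ratio b c = (w False b c + 4 * w True b c) / ((if b then 2 else 1) * (if c then 2 else 1))"

lemma prod_Suc_mod: "(\<Prod>x<L. f (Suc x mod L)) = (\<Prod>x<L. f x)"
  for f :: "nat \<Rightarrow> real"
  by (rule prod.reindex_bij_betw[OF bij_betw_Suc_mod])

text \<open>For given \<open>B\<close> the spins of \<open>A\<close> are independent, so the sum
  factorises over positions. Each spin of \<open>B\<close> enters the factors at two positions, so
  the denominators of \<open>ratio\<close> multiply to \<open>height B\<close>.\<close>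

lemma sum_height_diag_weight:
  "(\<Sum>A\<in>{..<L} \<rightarrow>\<^sub>E UNIV. height A * diag_weight A B) =
     (\<Prod>x<L. ratio (B x) (B (Suc x mod L))) * height B"
proof -
  have "(\<Sum>A\<in>{..<L} \<rightarrow>\<^sub>E UNIV. height A * diag_weight A B) =
    (\<Prod>x<L. w False (B x) (B (Suc x mod L)) + 4 * w True (B x) (B (Suc x mod L)))"
    unfolding height_def diag_weight_def prod.distrib[symmetric]
    by (subst prod_sum_PiE[symmetric]) (auto simp: UNIV_bool)
  also have "\<dots> = (\<Prod>x<L. ratio (B x) (B (Suc x mod L)) *
      ((if B x then 2 else 1) * (if B (Suc x mod L) then 2 else 1)))"
    by (intro prod.cong) (auto simp: ratio_def)
  also have "\<dots> = (\<Prod>x<L. ratio (B x) (B (Suc x mod L))) *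
      ((\<Prod>x<L. if B x then 2 else 1) * (\<Prod>x<L. if B (Suc x mod L) then 2 else 1))"
    unfolding prod.distrib ..
  also have "(\<Prod>x<L. if B (Suc x mod L) then 2 else (1::real)) = (\<Prod>x<L. if B x then 2 else 1)"
    by (rule prod_Suc_mod)
  also have "(\<Prod>x<L. if B x then 2 else 1) * (\<Prod>x<L. if B x then 2 else 1) = height B"
    unfolding height_def prod.distrib[symmetric] by (intro prod.cong) auto
  finally show ?thesis .
qed

lemma ratio_bounds:
  "0 \<le> ratio b c" "ratio False False = 1" "b \<noteq> c \<Longrightarrow> ratio b c \<le> 5 / 8" "ratio True True \<le> 9 / 16"
  using nonneg[of False b c] nonneg[of True b c] mixed[of b c] both absorbing
  by (auto simp: ratio_def)

text \<open>Since 9/16 is the square of 3/4 and 5/8 is below 3/4, every \<open>True\<close> spin can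
  be charged 3/4 in each of the two ratios that contain it.\<close>

lemma prod_ratio_le_weight:
  "(\<Prod>x<L. ratio (B x) (B (Suc x mod L))) \<le> (\<Prod>x<L. if B x then 9 / 16 else 1)"
proof -
  have "ratio b c \<le> (if b then 3 / 4 else 1) * (if c then 3 / 4 else 1)" for b c
    using ratio_bounds(2,4) ratio_bounds(3)[of b c] by (cases b; cases c) auto
  then have "(\<Prod>x<L. ratio (B x) (B (Suc x mod L))) \<le>
      (\<Prod>x<L. (if B x then 3 / 4 else 1) * (if B (Suc x mod L) then 3 / 4 else 1))"
    by (intro prod_mono) (auto simp: ratio_bounds)
  also have "\<dots> = (\<Prod>x<L. if B x then 3 / 4 else 1) * (\<Prod>x<L. if B x then 3 / 4 else 1)"
    unfolding prod.distrib by (subst prod_Suc_mod[of "\<lambda>x. if B x then 3 / 4 else 1"]) (rule refl)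
  also have "\<dots> = (\<Prod>x<L. if B x then 9 / 16 else 1)"
    unfolding prod.distrib[symmetric] by (intro prod.cong) auto
  finally show ?thesis .
qed

text \<open>A nonconstant pattern on a cycle changes value at least twice, once in each direction,
  and the all-\<open>True\<close> pattern has two positions because \<open>2 \<le> L\<close>. In
  both cases two ratios are at most 5/8 while no ratio exceeds 1.\<close>

lemma prod_ratio_le:
  assumes "x < L" "B x"
  shows "(\<Prod>x<L. ratio (B x) (B (Suc x mod L))) \<le> 25 / 64"
proof -
  let ?f = "\<lambda>x. ratio (B x) (B (Suc x mod L))"
  have "\<exists>y<L. \<exists>z<L. y \<noteq> z \<and> ?f y \<le> 5 / 8 \<and> ?f z \<le> 5 / 8"
  proof (cases "\<forall>y<L. B y")
    case True
    with L have "?f 0 \<le> 5 / 8" "?f 1 \<le> 5 / 8" using ratio_bounds(4) by auto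
    moreover have "0 < L" "1 < L" "(0::nat) \<noteq> 1" using L by auto
    ultimately show ?thesis by metis
  next
    case False
    then obtain x' where x': "x' < L" "\<not> B x'" by auto
    \<comment> \<open>Without such a change, \<open>True\<close> would propagate around the cycle
      from \<open>x\<close> to \<open>x'\<close>.\<close>
    obtain y where "y < L" "B y" "\<not> B (Suc y mod L)"
      using cyclic_induct[of L B x x'] assms x' by blast
    moreover obtain z where "z < L" "\<not> B z" "B (Suc z mod L)"
      using cyclic_induct[of L "\<lambda>x. \<not> B x" x' x] assms x' by metis
    moreover have "?f y \<le> 5 / 8" "?f z \<le> 5 / 8"
      using calculation by - (rule ratio_bounds(3), simp)+
    ultimately show ?thesis by metis
  qed
  then obtain y z where "y < L" "z < L" "y \<noteq> z" "?f y \<le> 5 / 8" "?f z \<le> 5 / 8" by auto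
  moreover have "ratio b c \<le> 1" for b c
    using ratio_bounds(2,4) ratio_bounds(3)[of b c] by (cases b; cases c) auto
  ultimately have "prod ?f {..<L} \<le> (5 / 8)\<^sup>2"
    by (intro prod_le_two_factors[of _ y z]) (auto simp: ratio_bounds)
  then show ?thesis by (simp add: power2_eq_square)
qed

text \<open>The all-\<open>False\<close> diagonal has all ratios equal to 1, so no contraction holds
  for it; it is excluded here and treated in \<open>diagonal_sum_le\<close>.\<close>

definition spin_diagonals :: "(nat \<Rightarrow> bool) set" where
  "spin_diagonals = {B \<in> {..<L} \<rightarrow>\<^sub>E UNIV. \<exists>x<L. B x}"

lemma diag_weight_nonneg: "0 \<le> diag_weight A B"
  unfolding diag_weight_def by (intro prod_nonneg) (simp add: nonneg)

lemma spin_diagonal_sum_le: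
  "(\<Sum>u\<in>{..<L} \<rightarrow>\<^sub>E spin_diagonals. \<Prod>t<L. diag_weight (u (Suc t mod L)) (u t))
    \<le> (25 / 64) ^ (L - 1) * (25 / 16) ^ L"
proof -
  let ?c = "\<lambda>B :: nat \<Rightarrow> bool. \<Prod>x<L. if B x then 9 / 16 else (1::real)"
  have height: "0 < height B" for B unfolding height_def by (intro prod_pos) auto
  have sub: "spin_diagonals \<subseteq> {..<L} \<rightarrow>\<^sub>E UNIV" unfolding spin_diagonals_def by auto
  have fin: "finite ({..<L} \<rightarrow>\<^sub>E (UNIV :: bool set))" by (intro finite_PiE) auto
  have *: "(\<Sum>A\<in>spin_diagonals. height A * diag_weight A B) \<le>
      (\<Prod>x<L. ratio (B x) (B (Suc x mod L))) * height B" for B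
    unfolding sum_height_diag_weight[symmetric]
    using height diag_weight_nonneg
    by (intro sum_mono2 fin sub) (auto intro: mult_nonneg_nonneg less_imp_le)
  have "(\<Sum>A\<in>spin_diagonals. height A * diag_weight A B) \<le> 25 / 64 * height B"
    if "B \<in> spin_diagonals" for B
  proof -
    have "(\<Prod>x<L. ratio (B x) (B (Suc x mod L))) \<le> 25 / 64"
      using that prod_ratio_le unfolding spin_diagonals_def by auto
    then show ?thesis using *[of B] height[of B] by (meson less_imp_le mult_right_mono order_trans)
  qed
  moreover have "(\<Sum>A\<in>spin_diagonals. height A * diag_weight A B) \<le> ?c B * height B" for B
    using *[of B] height[of B] prod_ratio_le_weight[of B]
    by (meson less_imp_le mult_right_mono order_trans)
  ultimately have "(\<Sum>u\<in>{..<L} \<rightarrow>\<^sub>E spin_diagonals. \<Prod>t<L. diag_weight (u (Suc t mod L)) (u t))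
      \<le> (25 / 64) ^ (L - 1) * (\<Sum>B\<in>spin_diagonals. ?c B)"
    using height diag_weight_nonneg L finite_subset[OF sub fin]
    by (intro closed_path_sum_le[where h = height]) auto
  moreover have "(\<Sum>B\<in>spin_diagonals. ?c B) \<le> (25 / 16) ^ L"
  proof -
    have "(\<Sum>B\<in>spin_diagonals. ?c B) \<le> (\<Sum>B\<in>{..<L} \<rightarrow>\<^sub>E UNIV. ?c B)"
      by (intro sum_mono2 fin sub prod_nonneg) auto
    also have "\<dots> = (\<Prod>x<L. \<Sum>b\<in>UNIV. if b then 9 / 16 else 1)"
      by (rule prod_sum_PiE[symmetric]) auto
    also have "\<dots> = (25 / 16) ^ L" by (simp add: UNIV_bool)
    finally show ?thesis .
  qed
  ultimately show ?thesis
    by (meson mult_left_mono order_trans zero_le_power zero_le_divide_iff zero_le_numeral)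
qed

text \<open>On a closed path absorption is total: one all-\<open>False\<close> diagonal forces the
  next one, and after a full turn every diagonal. The only contributing path that leaves
  \<open>spin_diagonals\<close> is therefore \<open>u0\<close>, with weight 1.\<close>

lemma diagonal_sum_le:
  "(\<Sum>u\<in>{..<L} \<rightarrow>\<^sub>E ({..<L} \<rightarrow>\<^sub>E UNIV). \<Prod>t<L. diag_weight (u (Suc t mod L)) (u t))
    \<le> 1 + (25 / 64) ^ (L - 1) * (25 / 16) ^ L"
proof -
  let ?F = "\<lambda>u. \<Prod>t<L. diag_weight (u (Suc t mod L)) (u t)"
  define u0 where "u0 = (\<lambda>t\<in>{..<L}. \<lambda>x\<in>{..<L}. False)"
  have fin: "finite ({..<L} \<rightarrow>\<^sub>E ({..<L} \<rightarrow>\<^sub>E (UNIV :: bool set)))" by (intro finite_PiE) auto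
  have sub: "insert u0 ({..<L} \<rightarrow>\<^sub>E spin_diagonals) \<subseteq> {..<L} \<rightarrow>\<^sub>E ({..<L} \<rightarrow>\<^sub>E UNIV)"
    unfolding u0_def spin_diagonals_def by (auto simp: PiE_def Pi_def)
  have zero: "?F u = 0"
    if u: "u \<in> {..<L} \<rightarrow>\<^sub>E ({..<L} \<rightarrow>\<^sub>E UNIV)" "u \<notin> {..<L} \<rightarrow>\<^sub>E spin_diagonals" "u \<noteq> u0" for u
  proof (rule ccontr)
    assume nz: "?F u \<noteq> 0"
    obtain t where t: "t < L" "\<forall>x<L. \<not> u t x"
      using u unfolding spin_diagonals_def by (auto simp: PiE_def Pi_def)
    have "\<forall>x<L. \<not> u t' x" if "t' < L" for t'
    proof (rule cyclic_induct[of L "\<lambda>t. \<forall>x<L. \<not> u t x" t])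
      fix t assume t: "t < L" "\<forall>x<L. \<not> u t x"
      show "\<forall>x<L. \<not> u (Suc t mod L) x"
      proof (intro allI impI notI)
        fix x assume "x < L" "u (Suc t mod L) x"
        moreover from \<open>x < L\<close> t have "\<not> u t x" "\<not> u t (Suc x mod L)" by auto
        ultimately have "w (u (Suc t mod L) x) (u t x) (u t (Suc x mod L)) = 0"
          using absorbing by simp
        with \<open>x < L\<close> have "diag_weight (u (Suc t mod L)) (u t) = 0"
          unfolding diag_weight_def by (auto simp: prod_zero_iff)
        with t nz show False by (auto simp: prod_zero_iff)
      qed
    qed (use t that in auto)
    then have "u = u0"
      using u(1) unfolding u0_def by (auto simp: fun_eq_iff PiE_def Pi_def extensional_def restrict_def)
    with u show False by simp
  qed
  have "u0 \<notin> {..<L} \<rightarrow>\<^sub>E spin_diagonals"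
    using L unfolding u0_def spin_diagonals_def by (auto simp: PiE_def Pi_def intro!: exI[of _ 0])
  moreover have "finite ({..<L} \<rightarrow>\<^sub>E spin_diagonals)"
    using finite_subset[OF sub fin] by simp
  moreover have "sum ?F ({..<L} \<rightarrow>\<^sub>E ({..<L} \<rightarrow>\<^sub>E UNIV)) = sum ?F (insert u0 ({..<L} \<rightarrow>\<^sub>E spin_diagonals))"
    using zero by (intro sum.mono_neutral_right fin sub) auto
  moreover have "?F u0 = 1"
    unfolding u0_def diag_weight_def using L by (simp add: absorbing)
  ultimately show ?thesis using spin_diagonal_sum_le by simp
qed

end

section \<open>Slicing the torus into diagonals\<close>

definition right :: "nat \<Rightarrow> nat \<times> nat \<Rightarrow> nat \<times> nat" where
  "right L = (\<lambda>(x, y). (x, (y + 1) mod L))"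

definition down :: "nat \<Rightarrow> nat \<times> nat \<Rightarrow> nat \<times> nat" where
  "down L = (\<lambda>(x, y). ((x + 1) mod L, y))"

lemma finite_sites [simp]: "finite (sites L)"
  by (simp add: sites_def)

lemma bij_right: "bij_betw (right L) (sites L) (sites L)"
proof -
  have "right L = map_prod id (\<lambda>y. Suc y mod L)" by (auto simp: right_def)
  then show ?thesis
    unfolding sites_def by (simp only:) (rule bij_betw_map_prod[OF bij_betw_id bij_betw_Suc_mod])
qed

lemma bij_down: "bij_betw (down L) (sites L) (sites L)"
proof -
  have "down L = map_prod (\<lambda>x. Suc x mod L) id" by (auto simp: down_def)
  then show ?thesis
    unfolding sites_def by (simp only:) (rule bij_betw_map_prod[OF bij_betw_Suc_mod bij_betw_id])
qed

context spin_model
begin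

text \<open>The solution \<open>y\<close> of x + y = -t modulo \<open>L\<close>, hence an involution
  in \<open>t\<close> for fixed \<open>x\<close>. The minus sign makes the right and lower
  neighbours of a site on diagonal t + 1 lie on diagonal t.\<close>

definition reflect :: "nat \<Rightarrow> nat \<Rightarrow> nat" where
  "reflect t x = nat ((- int x - int t) mod int L)"

lemma int_reflect: "int (reflect t x) = (- int x - int t) mod int L"
  using L by (simp add: reflect_def)

lemma reflect_less: "reflect t x < L"
proof -
  have "int (reflect t x) < int L" using L by (simp add: int_reflect)
  then show ?thesis by simp
qed

lemma reflect_reflect: "t < L \<Longrightarrow> reflect (reflect t x) x = t"
proof -
  assume "t < L"
  have "int (reflect (reflect t x) x) = int t mod int L"
    unfolding int_reflect mod_diff_right_eq by simp
  with \<open>t < L\<close> show ?thesis by simp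
qed

lemma reflect_Suc_right: "Suc (reflect (Suc t mod L) x) mod L = reflect t x"
proof -
  have "int (Suc (reflect (Suc t mod L) x) mod L) = (1 + (- int x - (1 + int t) mod int L) mod int L) mod int L"
    by (simp add: zmod_int int_reflect)
  also have "\<dots> = int (reflect t x)"
    unfolding int_reflect mod_diff_right_eq mod_add_right_eq by simp
  finally show ?thesis by simp
qed

lemma reflect_Suc_down: "reflect t (Suc x mod L) = reflect (Suc t mod L) x"
proof -
  have "int (reflect t (Suc x mod L)) = (- ((1 + int x) mod int L) - int t) mod int L"
    by (simp add: zmod_int int_reflect)
  also have "\<dots> = (- int t - (1 + int x) mod int L) mod int L"
    by (simp only: minus_diff_commute)
  also have "\<dots> = (- int x - (1 + int t) mod int L) mod int L"
    unfolding mod_diff_right_eq by (rule arg_cong[where f = "\<lambda>z. z mod int L"]) linarith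
  also have "\<dots> = int (reflect (Suc t mod L) x)"
    by (simp add: zmod_int int_reflect)
  finally show ?thesis by simp
qed

text \<open>The cyclic shift of \<open>t\<close> puts the site itself on diagonal t + 1 and its
  neighbours on diagonal t, as in the arguments of \<open>diag_weight\<close>.\<close>

lemma prod_sites: "(\<Prod>v\<in>sites L. f v) = (\<Prod>t<L. \<Prod>x<L. f (x, reflect (Suc t mod L) x))"
  for f :: "_ \<Rightarrow> real"
proof -
  have "(\<Prod>v\<in>sites L. f v) = (\<Prod>x<L. \<Prod>y<L. f (x, y))"
    unfolding sites_def by (simp add: prod.cartesian_product)
  also have "\<dots> = (\<Prod>x<L. \<Prod>t<L. f (x, reflect t x))"
  proof (rule prod.cong[OF refl])
    show "(\<Prod>y<L. f (x, y)) = (\<Prod>t<L. f (x, reflect t x))" for x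
      by (rule prod.reindex_bij_witness[where i = "\<lambda>t. reflect t x" and j = "\<lambda>t. reflect t x"])
         (auto simp: reflect_less reflect_reflect)
  qed
  also have "\<dots> = (\<Prod>t<L. \<Prod>x<L. f (x, reflect t x))"
    by (rule prod.swap)
  also have "\<dots> = (\<Prod>t<L. \<Prod>x<L. f (x, reflect (Suc t mod L) x))"
    by (rule prod_Suc_mod[symmetric])
  finally show ?thesis .
qed

lemma torus_sum_le:
  "(\<Sum>\<sigma>\<in>sites L \<rightarrow>\<^sub>E UNIV. \<Prod>v\<in>sites L. w (\<sigma> v) (\<sigma> (right L v)) (\<sigma> (down L v)))
    \<le> 1 + (25 / 64) ^ (L - 1) * (25 / 16) ^ L"
proof -
  let ?i = "\<lambda>u. \<lambda>(x, y)\<in>sites L. u (reflect y x) x"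
  let ?j = "\<lambda>\<sigma>. \<lambda>t\<in>{..<L}. \<lambda>x\<in>{..<L}. \<sigma> (x, reflect t x)"
  have "(\<Sum>\<sigma>\<in>sites L \<rightarrow>\<^sub>E UNIV. \<Prod>v\<in>sites L. w (\<sigma> v) (\<sigma> (right L v)) (\<sigma> (down L v))) =
    (\<Sum>u\<in>{..<L} \<rightarrow>\<^sub>E ({..<L} \<rightarrow>\<^sub>E UNIV). \<Prod>t<L. diag_weight (u (Suc t mod L)) (u t))"
  proof (rule sum.reindex_bij_witness[where i = ?i and j = ?j])
    fix \<sigma> :: "nat \<times> nat \<Rightarrow> bool" assume \<sigma>: "\<sigma> \<in> sites L \<rightarrow>\<^sub>E UNIV"
    show "?i (?j \<sigma>) = \<sigma>"
      using \<sigma> by (auto simp: fun_eq_iff PiE_def extensional_def restrict_def sites_def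
          reflect_less reflect_reflect)
    show "?j \<sigma> \<in> {..<L} \<rightarrow>\<^sub>E ({..<L} \<rightarrow>\<^sub>E UNIV)" by auto
    show "(\<Prod>t<L. diag_weight (?j \<sigma> (Suc t mod L)) (?j \<sigma> t)) =
        (\<Prod>v\<in>sites L. w (\<sigma> v) (\<sigma> (right L v)) (\<sigma> (down L v)))"
      unfolding prod_sites diag_weight_def
      using L by (intro prod.cong refl)
        (simp add: right_def down_def reflect_Suc_right reflect_Suc_down)
  next
    fix u :: "nat \<Rightarrow> nat \<Rightarrow> bool" assume u: "u \<in> {..<L} \<rightarrow>\<^sub>E ({..<L} \<rightarrow>\<^sub>E UNIV)"
    show "?i u \<in> sites L \<rightarrow>\<^sub>E UNIV" by auto
    show "?j (?i u) = u"
    proof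
      fix t
      show "?j (?i u) t = u t"
      proof (cases "t < L")
        case True
        then have "u t \<in> {..<L} \<rightarrow>\<^sub>E UNIV" using u by auto
        with True show ?thesis
          by (auto simp: fun_eq_iff PiE_def extensional_def restrict_def sites_def
              reflect_less reflect_reflect)
      next
        case False
        with u show ?thesis by (auto simp: PiE_def extensional_def)
      qed
    qed
  qed
  then show ?thesis using diagonal_sum_le by simp
qed

end

section \<open>Moments of the Haar measure\<close>

text \<open>Each pair holds the index of a conjugated entry and then that of a plain entry, one pair
  per copy of the matrix. The two values of \<open>s\<close> stand for the two permutations of the
  copies.\<close>

definition matching :: "bool \<Rightarrow> ('i \<times> 'i) \<times> ('i \<times> 'i) \<Rightarrow> complex" where
  "matching s = (\<lambda>((i', i), (j', j)). of_bool (if s then i' = j \<and> j' = i else i' = i \<and> j' = j))"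

definition moment ::
  "(complex^'n^'n) measure \<Rightarrow> ('n \<times> 'n) \<times> ('n \<times> 'n) \<Rightarrow> ('n \<times> 'n) \<times> ('n \<times> 'n) \<Rightarrow> complex" where
  "moment \<mu> = (\<lambda>((i', i), (j', j)) ((k', k), (l', l)).
     \<integral>U. cnj (U $ i' $ k') * U $ i $ k * (cnj (U $ j' $ l') * U $ j $ l) \<partial>\<mu>)"

text \<open>The inverse of the 2 by 2 Gram matrix of the pairings, which has
  \<open>n\<^sup>2\<close> on the diagonal and \<open>n\<close> off it.\<close>

definition weingarten :: "real \<Rightarrow> bool \<Rightarrow> bool \<Rightarrow> real" where
  "weingarten n s t = (if s = t then 1 / (n\<^sup>2 - 1) else - 1 / (n * (n\<^sup>2 - 1)))"

section \<open>Elementary properties of unitary matrices\<close>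

lemma unitary_sum_rows:
  assumes "U \<in> unitary_group"
  shows "(\<Sum>i\<in>UNIV. cnj (U $ i $ k') * U $ i $ k) = of_bool (k' = k)"
proof -
  have "(cadjoint U ** U) $ k' $ k = mat 1 $ k' $ k" using assms by (simp add: unitary_group_def)
  then show ?thesis by (simp add: matrix_matrix_mult_def cadjoint_def mat_def)
qed

lemma unitary_sum_columns:
  assumes "U \<in> unitary_group"
  shows "(\<Sum>k\<in>UNIV. cnj (U $ i $ k) * U $ j $ k) = of_bool (i = j)"
proof -
  have "(U ** cadjoint U) $ j $ i = mat 1 $ j $ i" using assms by (simp add: unitary_group_def)
  then show ?thesis by (auto simp: matrix_matrix_mult_def cadjoint_def mat_def mult.commute)
qed

lemma unitary_entry_le:
  assumes "U \<in> unitary_group"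
  shows "cmod (U $ i $ k) \<le> 1"
proof -
  have "complex_of_real (\<Sum>k\<in>UNIV. (cmod (U $ i $ k))\<^sup>2) = 1"
    unfolding of_real_sum complex_norm_square
    using unitary_sum_columns[OF assms, of i i] by (simp add: mult.commute)
  then have "(\<Sum>k\<in>UNIV. (cmod (U $ i $ k))\<^sup>2) = 1"
    using of_real_eq_1_iff by blast
  moreover have "(cmod (U $ i $ k))\<^sup>2 \<le> (\<Sum>k\<in>UNIV. (cmod (U $ i $ k))\<^sup>2)"
    by (rule member_le_sum) auto
  ultimately show ?thesis by (simp add: abs_square_le_1)
qed

lemma unitary_mult:
  assumes "U \<in> unitary_group" "V \<in> unitary_group"
  shows "U ** V \<in> unitary_group"
proof -
  have adj: "cadjoint (U ** V) = cadjoint V ** cadjoint U"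
    by (simp add: cadjoint_def matrix_matrix_mult_def vec_eq_iff cnj_sum mult.commute)
  have "cadjoint V ** cadjoint U ** (U ** V) = cadjoint V ** (cadjoint U ** U) ** V"
    by (simp add: matrix_mul_assoc)
  moreover have "U ** V ** (cadjoint V ** cadjoint U) = U ** (V ** cadjoint V) ** cadjoint U"
    by (simp add: matrix_mul_assoc)
  ultimately show ?thesis using assms by (simp add: unitary_group_def adj)
qed

lemma exists_bij_two_points:
  fixes a b a' b' :: 'a
  assumes "a \<noteq> b" "a' \<noteq> b'"
  shows "\<exists>\<pi>. bij \<pi> \<and> \<pi> a = a' \<and> \<pi> b = b'"
proof -
  let ?\<tau> = "Transposition.transpose a a'"
  have "?\<tau> b \<noteq> a'" using assms(1) by (metis transpose_apply_first transpose_involutory)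
  with assms(2) show ?thesis
    by (intro exI[of _ "Transposition.transpose (?\<tau> b) b' \<circ> ?\<tau>"])
       (auto simp: bij_comp transpose_apply_other)
qed

locale haar =
  fixes \<mu> :: "(complex^'n^'n) measure"
  assumes haar: "haar_unitary \<mu>"
begin

sublocale prob_space \<mu>
  using haar by (simp add: haar_unitary_def)

lemma sets_\<mu>: "sets \<mu> = sets (restrict_space borel unitary_group)"
  using haar by (simp add: haar_unitary_def)

lemma space_\<mu>: "space \<mu> = unitary_group"
  using sets_eq_imp_space_eq[OF sets_\<mu>] by (simp add: space_restrict_space)

lemma measurable_continuous:
  fixes f :: "complex^'n^'n \<Rightarrow> 'a::topological_space"
  assumes "continuous_on UNIV f"
  shows "f \<in> borel_measurable \<mu>"
  unfolding measurable_cong_sets[OF sets_\<mu> refl]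
  using borel_measurable_continuous_onI[OF assms] by (rule measurable_restrict_space1)

lemma measurable_mult_left:
  assumes "V \<in> unitary_group"
  shows "(\<lambda>U. V ** U) \<in> measurable \<mu> \<mu>"
proof -
  have "(\<lambda>U. V ** U) \<in> measurable \<mu> (restrict_space borel unitary_group)"
  proof (rule measurable_restrict_space2)
    show "(\<lambda>U. V ** U) \<in> borel_measurable \<mu>"
      unfolding matrix_matrix_mult_def
      by (rule measurable_continuous) (intro continuous_intros)
  qed (use assms in \<open>auto simp: space_\<mu> unitary_mult\<close>)
  then show ?thesis unfolding measurable_cong_sets[OF refl sets_\<mu>] .
qed

lemma integral_mult_left_invariant:
  fixes f :: "complex^'n^'n \<Rightarrow> complex"
  assumes "V \<in> unitary_group" "f \<in> borel_measurable \<mu>"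
  shows "(\<integral>U. f (V ** U) \<partial>\<mu>) = (\<integral>U. f U \<partial>\<mu>)"
proof -
  have "distr \<mu> \<mu> (\<lambda>U. V ** U) = \<mu>" using haar assms(1) by (simp add: haar_unitary_def)
  then show ?thesis
    using integral_distr[OF measurable_mult_left[OF assms(1)] assms(2)] by simp
qed

lemma measurable_quartic [measurable]:
  "(\<lambda>U. cnj (U $ i' $ k') * U $ i $ k * (cnj (U $ j' $ l') * U $ j $ l)) \<in> borel_measurable \<mu>"
  by (rule measurable_continuous) (intro continuous_intros)

lemma measurable_quadratic [measurable]:
  "(\<lambda>U. cnj (U $ i' $ k') * U $ i $ k) \<in> borel_measurable \<mu>"
  by (rule measurable_continuous) (intro continuous_intros)

lemma integrable_quartic:
  "integrable \<mu> (\<lambda>U. cnj (U $ i' $ k') * U $ i $ k * (cnj (U $ j' $ l') * U $ j $ l))"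
proof (rule integrable_const_bound[where B = 1])
  show "AE U in \<mu>. cmod (cnj (U $ i' $ k') * U $ i $ k * (cnj (U $ j' $ l') * U $ j $ l)) \<le> 1"
    by (rule AE_I2) (auto simp: space_\<mu> norm_mult unitary_entry_le intro!: mult_le_one)
qed (rule measurable_quartic)

lemma integrable_quadratic: "integrable \<mu> (\<lambda>U. cnj (U $ i' $ k') * U $ i $ k)"
proof (rule integrable_const_bound[where B = 1])
  show "AE U in \<mu>. cmod (cnj (U $ i' $ k') * U $ i $ k) \<le> 1"
    by (rule AE_I2) (auto simp: space_\<mu> norm_mult unitary_entry_le intro!: mult_le_one)
qed (rule measurable_quadratic)

lemma moment_mult_left:
  assumes "V \<in> unitary_group"
  shows "moment \<mu> ((i', i), (j', j)) ((k', k), (l', l)) =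
    (\<integral>U. cnj ((V ** U) $ i' $ k') * (V ** U) $ i $ k * (cnj ((V ** U) $ j' $ l') * (V ** U) $ j $ l) \<partial>\<mu>)"
  unfolding moment_def using integral_mult_left_invariant[OF assms,
      of "\<lambda>U. cnj (U $ i' $ k') * U $ i $ k * (cnj (U $ j' $ l') * U $ j $ l)", OF measurable_quartic]
  by simp

lemma moment_phase:
  assumes "\<And>i. cmod (z i) = 1"
  shows "moment \<mu> ((i', i), (j', j)) c =
    cnj (z i') * z i * (cnj (z j') * z j) * moment \<mu> ((i', i), (j', j)) c"
proof -
  define V :: "complex^'n^'n" where "V = (\<chi> i j. if i = j then z i else 0)"
  have V: "(V ** U) $ i $ k = z i * U $ i $ k" for U :: "complex^'n^'n" and i k
    by (simp add: V_def matrix_matrix_mult_def if_distrib[of "\<lambda>x. x * _"] cong: if_cong)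
  have *: "z i * cnj (z i) = 1" for i
    using assms[of i] by (simp add: complex_norm_square[symmetric])
  have "V \<in> unitary_group"
    by (auto simp: unitary_group_def cadjoint_def matrix_matrix_mult_def vec_eq_iff V_def mat_def
        if_distrib[of "\<lambda>x. x * _"] if_distrib[of cnj] * mult.commute[of "cnj (z _)"] cong: if_cong)
  obtain k' k l' l where c: "c = ((k', k), (l', l))" by (metis surj_pair)
  have "moment \<mu> ((i', i), (j', j)) c = (\<integral>U. cnj (z i') * z i * (cnj (z j') * z j) *
      (cnj (U $ i' $ k') * U $ i $ k * (cnj (U $ j' $ l') * U $ j $ l)) \<partial>\<mu>)"
    unfolding c moment_mult_left[OF \<open>V \<in> unitary_group\<close>] V by (simp add: mult_ac)
  then show ?thesis
    unfolding c moment_def prod.case by (simp only: integral_mult_right_zero)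
qed

text \<open>Multiplying one row \<open>a\<close> by a phase rescales the moment by a power of that
  phase, whose exponent is the difference of the multiplicities of \<open>a\<close> among the plain
  and the conjugated row indices.\<close>

lemma moment_zero:
  assumes "\<not> (i' = i \<and> j' = j)" "\<not> (i' = j \<and> j' = i)"
  shows "moment \<mu> ((i', i), (j', j)) c = 0"
proof -
  have *: "moment \<mu> ((i', i), (j', j)) c = 0"
    if "cnj (z i') * z i * (cnj (z j') * z j) \<noteq> 1" "\<And>i. cmod (z i) = 1" for z
    using moment_phase[of z i' i j' j c] that by auto
  have "\<exists>a. of_bool (i = a) + of_bool (j = a) \<noteq> (of_bool (i' = a) + of_bool (j' = a) :: nat)"
    using assms by (intro exI[of _ "if i = i' \<or> i = j' then j else i"]) auto
  then obtain a where "of_bool (i = a) + of_bool (j = a) \<noteq> (of_bool (i' = a) + of_bool (j' = a) :: nat)" ..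
  \<comment> \<open>The multiplicities differ by at most 2, and \<i> has order 4, so the factor
    differs from 1; a sign would miss a difference of 2.\<close>
  then show ?thesis
    by (intro *[of "\<lambda>i. if i = a then \<i> else 1"]) (auto simp: complex_eq_iff split: if_splits)
qed

lemma moment_permute:
  assumes "bij \<pi>"
  shows "moment \<mu> ((\<pi> i', \<pi> i), (\<pi> j', \<pi> j)) c = moment \<mu> ((i', i), (j', j)) c"
proof -
  define V :: "complex^'n^'n" where "V = (\<chi> i j. if j = \<pi> i then 1 else 0)"
  have V: "(V ** U) $ i $ k = U $ \<pi> i $ k" for U :: "complex^'n^'n" and i k
    by (simp add: V_def matrix_matrix_mult_def if_distrib[of "\<lambda>x. x * _"] cong: if_cong)
  have inj: "\<pi> i = \<pi> j \<longleftrightarrow> i = j" for i j using assms by (simp add: bij_def inj_eq)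
  have "V ** cadjoint V = mat 1"
    by (simp add: vec_eq_iff V) (simp add: V_def cadjoint_def mat_def inj)
  moreover from this have "cadjoint V ** V = mat 1" by (simp add: matrix_left_right_inverse)
  ultimately have "V \<in> unitary_group" by (simp add: unitary_group_def)
  obtain k' k l' l where "c = ((k', k), (l', l))" by (metis surj_pair)
  then show ?thesis
    using moment_mult_left[OF \<open>V \<in> unitary_group\<close>, of i' i j' j k' k l' l]
    by (simp add: V moment_def)
qed

text \<open>Invariance under the rotation of the rows \<open>a\<close> and \<open>b\<close> into their normalised sum and difference.\<close>

lemma moment_coincident:
  assumes "a \<noteq> b"
  shows "4 * moment \<mu> ((a, a), (a, a)) c =
    moment \<mu> ((a, a), (a, a)) c + moment \<mu> ((b, b), (b, b)) c +
    moment \<mu> ((a, a), (b, b)) c + moment \<mu> ((b, b), (a, a)) c +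
    moment \<mu> ((b, a), (a, b)) c + moment \<mu> ((a, b), (b, a)) c"
proof -
  define s :: complex where "s = of_real (1 / sqrt 2)"
  have s: "s * s = 1 / 2" "cnj s = s"
    unfolding s_def by (auto simp flip: of_real_mult)
  define V :: "complex^'n^'n" where "V = (\<chi> i j.
    if i = a then s * of_bool (j = a) + s * of_bool (j = b)
    else if i = b then s * of_bool (j = a) - s * of_bool (j = b)
    else of_bool (j = i))"
  have V: "(V ** U) $ i $ k = (if i = a then s * U $ a $ k + s * U $ b $ k
    else if i = b then s * U $ a $ k - s * U $ b $ k else U $ i $ k)" for U :: "complex^'n^'n" and i k
    by (simp add: V_def matrix_matrix_mult_def algebra_simps sum.distrib sum_subtractf of_bool_def
        if_distrib[of "\<lambda>x. _ * x"] cong: if_cong)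
  have "cadjoint V = V"
    using assms by (auto simp: cadjoint_def V_def vec_eq_iff s)
  moreover have "V ** V = mat 1"
    using assms s(1) mult.commute[of 2 "s * s"] by (auto simp: vec_eq_iff V) (auto simp: V_def mat_def)
  ultimately have "V \<in> unitary_group" by (simp add: unitary_group_def)
  obtain k' k l' l where c: "c = ((k', k), (l', l))" by (metis surj_pair)
  have "moment \<mu> ((a, a), (a, a)) c = (\<integral>U. (\<Sum>i'\<in>{a, b}. \<Sum>i\<in>{a, b}. \<Sum>j'\<in>{a, b}. \<Sum>j\<in>{a, b}.
      1 / 4 * (cnj (U $ i' $ k') * U $ i $ k * (cnj (U $ j' $ l') * U $ j $ l))) \<partial>\<mu>)"
    unfolding c moment_mult_left[OF \<open>V \<in> unitary_group\<close>]
  proof (intro Bochner_Integration.integral_cong refl)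
    fix U :: "complex^'n^'n"
    have "cnj ((V ** U) $ a $ k') * (V ** U) $ a $ k * (cnj ((V ** U) $ a $ l') * (V ** U) $ a $ l) =
      (s * s) * (s * s) * ((cnj (U $ a $ k') + cnj (U $ b $ k')) * (U $ a $ k + U $ b $ k) *
       ((cnj (U $ a $ l') + cnj (U $ b $ l')) * (U $ a $ l + U $ b $ l)))"
      by (simp add: V s(2) algebra_simps)
    also have "\<dots> = (\<Sum>i'\<in>{a, b}. \<Sum>i\<in>{a, b}. \<Sum>j'\<in>{a, b}. \<Sum>j\<in>{a, b}.
      1 / 4 * (cnj (U $ i' $ k') * U $ i $ k * (cnj (U $ j' $ l') * U $ j $ l)))"
      using assms unfolding s(1) by (simp add: algebra_simps)
    finally show "cnj ((V ** U) $ a $ k') * (V ** U) $ a $ k * (cnj ((V ** U) $ a $ l') * (V ** U) $ a $ l) = \<dots>" .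
  qed
  also have "\<dots> = (\<Sum>i'\<in>{a, b}. \<Sum>i\<in>{a, b}. \<Sum>j'\<in>{a, b}. \<Sum>j\<in>{a, b}.
      1 / 4 * moment \<mu> ((i', i), (j', j)) c)"
    unfolding c moment_def prod.case
    by (subst Bochner_Integration.integral_sum;
        (intro Bochner_Integration.integrable_sum integrable_mult_right integrable_quartic)?)+
       (simp only: integral_mult_right_zero)
  \<comment> \<open>Of the sixteen terms only those survive whose plain and conjugated row indices
    agree as multisets.\<close>
  also have "\<dots> = 1 / 4 * (moment \<mu> ((a, a), (a, a)) c + moment \<mu> ((b, b), (b, b)) c +
    moment \<mu> ((a, a), (b, b)) c + moment \<mu> ((b, b), (a, a)) c +
    moment \<mu> ((b, a), (a, b)) c + moment \<mu> ((a, b), (b, a)) c)"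
    using assms by (simp add: moment_zero)
  finally show ?thesis by simp
qed

end

lemma matching_parallel:
  "matching False ((i, i), (j, j)) = 1"
  "matching True ((i, i), (j, j)) = of_bool (i = j)"
  "matching True ((j, i), (i, j)) = 1"
  "matching False ((j, i), (i, j)) = of_bool (i = j)"
  by (auto simp: matching_def)

lemma matching_half_parallel:
  "matching False ((k', k), (l, l)) = of_bool (k' = k)"
  "matching True ((k', k), (l, l)) = (if l = k then of_bool (k' = k) else 0)"
  by (auto simp: matching_def)

context haar
begin

text \<open>By permutation invariance only three values can occur: coincident, direct and crossed.
  The rotation identity becomes 4p = 2p + 2q + 2r, so the coincident value is the sum of the other
  two, which is what the formula requires where both pairings apply.\<close>

lemma moment_pairings:
  assumes "a \<noteq> b"
  shows "moment \<mu> r c =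
    matching False r * moment \<mu> ((a, a), (b, b)) c + matching True r * moment \<mu> ((b, a), (a, b)) c"
proof -
  let ?p = "moment \<mu> ((a, a), (a, a)) c" and ?q = "moment \<mu> ((a, a), (b, b)) c"
    and ?r = "moment \<mu> ((b, a), (a, b)) c"
  have q: "moment \<mu> ((x, x), (y, y)) c = ?q" if "x \<noteq> y" for x y
    using exists_bij_two_points[OF assms that] moment_permute[of _ a a b b c] by metis
  have r: "moment \<mu> ((y, x), (x, y)) c = ?r" if "x \<noteq> y" for x y
    using exists_bij_two_points[OF assms that] moment_permute[of _ b a a b c] by metis
  have p: "moment \<mu> ((x, x), (x, x)) c = ?p" for x
    using moment_permute[OF bij_transpose, of a x a a a a c] by simp
  have "2 * ?p = 2 * (?q + ?r)"
    using moment_coincident[OF assms, of c] q[of b a] r[of b a] p[of b] assms by simp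
  then have p_eq: "?p = ?q + ?r"
    by (simp only: mult_cancel_left) simp
  obtain i' i j' j where r_eq: "r = ((i', i), (j', j))" by (metis surj_pair)
  show ?thesis
  proof (cases "(i' = i \<and> j' = j) \<or> (i' = j \<and> j' = i)")
    case True
    then show ?thesis
      using p_eq p[of i] q[of i j] r[of i j] by (cases "i = j") (auto simp: r_eq matching_def)
  next
    case False
    then have "matching False r = 0" "matching True r = 0" by (auto simp: r_eq matching_def)
    moreover have "moment \<mu> r c = 0" unfolding r_eq using False by (intro moment_zero) auto
    ultimately show ?thesis by simp
  qed
qed

text \<open>Orthonormality of the columns, averaged. Together with the crossed version it gives two
  linear equations for the two unknown values in \<open>moment_pairings\<close>.\<close>

lemma sum_moment_direct:
  "(\<Sum>i\<in>UNIV. \<Sum>j\<in>UNIV. moment \<mu> ((i, i), (j, j)) c) = matching False c"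
proof -
  obtain k' k l' l where c: "c = ((k', k), (l', l))" by (metis surj_pair)
  have "(\<Sum>i\<in>UNIV. \<Sum>j\<in>UNIV. moment \<mu> ((i, i), (j, j)) c) =
    (\<integral>U. (\<Sum>i\<in>UNIV. \<Sum>j\<in>UNIV. cnj (U $ i $ k') * U $ i $ k * (cnj (U $ j $ l') * U $ j $ l)) \<partial>\<mu>)"
    by (simp add: c moment_def Bochner_Integration.integral_sum integrable_quartic
        Bochner_Integration.integrable_sum)
  also have "\<dots> = (\<integral>U. matching False c \<partial>\<mu>)"
  proof (intro Bochner_Integration.integral_cong refl)
    fix U assume "U \<in> space \<mu>"
    then show "(\<Sum>i\<in>UNIV. \<Sum>j\<in>UNIV. cnj (U $ i $ k') * U $ i $ k * (cnj (U $ j $ l') * U $ j $ l)) =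
        matching False c"
      unfolding sum_product[symmetric]
      by (simp add: space_\<mu> unitary_sum_rows c matching_def)
  qed
  finally show ?thesis by (simp add: prob_space)
qed

lemma sum_moment_crossed:
  "(\<Sum>i\<in>UNIV. \<Sum>j\<in>UNIV. moment \<mu> ((j, i), (i, j)) c) = matching True c"
proof -
  obtain k' k l' l where c: "c = ((k', k), (l', l))" by (metis surj_pair)
  have "(\<Sum>i\<in>UNIV. \<Sum>j\<in>UNIV. moment \<mu> ((j, i), (i, j)) c) =
    (\<integral>U. (\<Sum>i\<in>UNIV. \<Sum>j\<in>UNIV. cnj (U $ j $ k') * U $ i $ k * (cnj (U $ i $ l') * U $ j $ l)) \<partial>\<mu>)"
    by (simp add: c moment_def Bochner_Integration.integral_sum integrable_quartic
        Bochner_Integration.integrable_sum)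
  also have "\<dots> = (\<integral>U. matching True c \<partial>\<mu>)"
  proof (intro Bochner_Integration.integral_cong refl)
    fix U assume "U \<in> space \<mu>"
    have "(\<Sum>i\<in>UNIV. \<Sum>j\<in>UNIV. cnj (U $ j $ k') * U $ i $ k * (cnj (U $ i $ l') * U $ j $ l)) =
      (\<Sum>i\<in>UNIV. \<Sum>j\<in>UNIV. cnj (U $ i $ l') * U $ i $ k * (cnj (U $ j $ k') * U $ j $ l))"
      by (simp add: mult_ac)
    then show "(\<Sum>i\<in>UNIV. \<Sum>j\<in>UNIV. cnj (U $ j $ k') * U $ i $ k * (cnj (U $ i $ l') * U $ j $ l)) =
        matching True c"
      using \<open>U \<in> space \<mu>\<close> unfolding sum_product[symmetric]
      by (auto simp add: space_\<mu> unitary_sum_rows c matching_def)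
  qed
  finally show ?thesis by (simp add: prob_space)
qed

lemma moment_eq_weingarten:
  assumes n: "2 \<le> CARD('n)"
  shows "moment \<mu> r c =
    (\<Sum>s\<in>UNIV. \<Sum>t\<in>UNIV. matching s r * of_real (weingarten (real CARD('n)) s t) * matching t c)"
proof -
  obtain a b :: 'n where "a \<noteq> b"
    using n card_le_Suc0_iff_eq[of "UNIV :: 'n set"] by auto
  define q where "q = moment \<mu> ((a, a), (b, b)) c"
  define r' where "r' = moment \<mu> ((b, a), (a, b)) c"
  define m :: complex where "m = of_nat CARD('n)"
  have mom: "moment \<mu> r c = matching False r * q + matching True r * r'" for r
    unfolding q_def r'_def by (rule moment_pairings[OF \<open>a \<noteq> b\<close>])
  \<comment> \<open>Contracting the pairing formula over the rows gives a factor \<open>m\<close>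
    per closed loop. The resulting system has determinant
    \<open>m\<^sup>2 * (m\<^sup>2 - 1)\<close>.\<close>
  have F: "m\<^sup>2 * q + m * r' = matching False c"
    unfolding sum_moment_direct[of c, symmetric] mom matching_parallel
    by (simp add: sum.distrib m_def power2_eq_square algebra_simps flip: sum_distrib_right)
  have T: "m * q + m\<^sup>2 * r' = matching True c"
    unfolding sum_moment_crossed[of c, symmetric] mom matching_parallel
    by (simp add: sum.distrib m_def power2_eq_square algebra_simps flip: sum_distrib_right)
  have "real CARD('n) \<ge> 2" using n by simp
  then have "(real CARD('n))\<^sup>2 - 1 \<noteq> 0" "real CARD('n) \<noteq> 0"
    using power_mono[of 2 "real CARD('n)" 2] by auto
  then have "complex_of_real ((real CARD('n))\<^sup>2 - 1) \<noteq> 0" "complex_of_real (real CARD('n)) \<noteq> 0"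
    by (simp_all only: of_real_eq_0_iff not_False_eq_True)
  then have nz: "m\<^sup>2 - 1 \<noteq> 0" "m \<noteq> 0" by (simp_all add: m_def)
  define A B where "A = 1 / (m\<^sup>2 - 1)" and "B = - 1 / (m * (m\<^sup>2 - 1))"
  have q: "q = matching False c * A + matching True c * B"
    unfolding F[symmetric] T[symmetric] A_def B_def using nz by (simp add: divide_simps) algebra
  have r': "r' = matching True c * A + matching False c * B"
    unfolding F[symmetric] T[symmetric] A_def B_def using nz by (simp add: divide_simps) algebra
  have "complex_of_real (weingarten (real CARD('n)) s t) = (if s = t then A else B)" for s t
    by (simp add: weingarten_def m_def A_def B_def)
  then show ?thesis
    by (simp add: mom q r' UNIV_bool algebra_simps)
qed

text \<open>Reduced to the fourth-order moments by inserting the squared norm of another row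
  \<open>j\<close>, which is 1. The choice \<open>j \<noteq> i\<close> rules out the crossed pairing
  of the rows.\<close>

lemma first_moment:
  assumes n: "2 \<le> CARD('n)"
  shows "(\<integral>U. cnj (U $ i' $ k') * U $ i $ k \<partial>\<mu>) = of_bool (i' = i \<and> k' = k) / of_nat CARD('n)"
proof -
  obtain j where "j \<noteq> i"
    using n card_le_Suc0_iff_eq[of "UNIV :: 'n set"] by (metis finite not_less_eq_eq numeral_2_eq_2)
  define m where "m = real CARD('n)"
  have m: "m \<ge> 2" using n by (simp add: m_def)
  have "(\<integral>U. cnj (U $ i' $ k') * U $ i $ k \<partial>\<mu>) =
    (\<integral>U. (\<Sum>l\<in>UNIV. cnj (U $ i' $ k') * U $ i $ k * (cnj (U $ j $ l) * U $ j $ l)) \<partial>\<mu>)"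
    by (intro Bochner_Integration.integral_cong refl)
       (simp add: sum_distrib_left[symmetric] space_\<mu> unitary_sum_columns)
  also have "\<dots> = (\<Sum>l\<in>UNIV. moment \<mu> ((i', i), (j, j)) ((k', k), (l, l)))"
    by (simp add: moment_def Bochner_Integration.integral_sum integrable_quartic)
  also have "\<dots> = of_bool (i' = i \<and> k' = k) * of_real (m * weingarten m False False + weingarten m False True)"
    using \<open>j \<noteq> i\<close> unfolding moment_eq_weingarten[OF n] m_def[symmetric]
    by (auto simp: UNIV_bool matching_half_parallel sum.distrib m_def
        if_distrib[of "\<lambda>x. _ * x"] cong: if_cong)
  also have "m * weingarten m False False + weingarten m False True = 1 / m"
  proof -
    have "m\<^sup>2 - 1 \<noteq> 0" using m power_mono[of 2 m 2] by auto
    then show ?thesis using m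
      by (simp add: weingarten_def divide_simps) (simp add: algebra_simps power2_eq_square)
  qed
  finally show ?thesis by (simp add: m_def)
qed

end

section \<open>The squared norm as a tensor network\<close>

text \<open>Bra and ket tensors of one site, contracted over the physical index. In each doubled
  bond index the first component belongs to the conjugated tensor, as in
  \<open>matching\<close>.\<close>

definition site_weight ::
  "complex^'p::finite \<Rightarrow> complex^('b::finite \<times> 'b \<times> 'p)^('b \<times> 'b \<times> 'p) \<Rightarrow>
     'b \<times> 'b \<Rightarrow> 'b \<times> 'b \<Rightarrow> 'b \<times> 'b \<Rightarrow> 'b \<times> 'b \<Rightarrow> complex" where
  "site_weight e U a b c d = (\<Sum>j\<in>UNIV.
     cnj (site_tensor e U (fst a) (fst b) (fst c) (fst d) j) *
     site_tensor e U (snd a) (snd b) (snd c) (snd d) j)"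

lemma right_down_sites: "right L ` sites L \<subseteq> sites L" "down L ` sites L \<subseteq> sites L"
  using bij_right bij_down unfolding bij_betw_def by blast+

lemma tn_state_eq_tnet:
  "tn_state L e U j = tnet (sites L) (right L) (down L) (\<lambda>v a b c d. site_tensor e (U v) a b c d (j v))"
  unfolding tn_state_def tnet_def right_def down_def
  by (intro sum.cong prod.cong refl) (simp add: split_def)

lemma tensor_inner_eq_tnet:
  "tensor_inner L (tn_state L e U) (tn_state L e U) =
     tnet (sites L) (right L) (down L) (\<lambda>v. site_weight e (U v))"
proof -
  have "tensor_inner L (tn_state L e U) (tn_state L e U) =
    (\<Sum>j\<in>sites L \<rightarrow>\<^sub>E UNIV. tnet (sites L) (right L) (down L)
      (\<lambda>v a b c d. cnj (site_tensor e (U v) (fst a) (fst b) (fst c) (fst d) (j v)) *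
         site_tensor e (U v) (snd a) (snd b) (snd c) (snd d) (j v)))"
    unfolding tensor_inner_def tn_state_eq_tnet cnj_tnet tnet_mult[OF right_down_sites] ..
  also have "\<dots> = tnet (sites L) (right L) (down L) (\<lambda>v. site_weight e (U v))"
    unfolding site_weight_def
    by (rule sum_tnet[of _ _ _ "\<lambda>v j a b c d. cnj (site_tensor e (U v) (fst a) (fst b) (fst c) (fst d) j) *
         site_tensor e (U v) (snd a) (snd b) (snd c) (snd d) j"]) simp
  finally show ?thesis .
qed

section \<open>Contractions of pairings\<close>

lemma sum_UNIV_prod: "(\<Sum>x\<in>UNIV. \<Sum>y\<in>UNIV. f x y) = (\<Sum>z\<in>UNIV. f (fst z) (snd z))"
  unfolding sum.cartesian_product UNIV_Times_UNIV by (simp add: split_def)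

lemma sum_prod_split: "(\<Sum>z\<in>UNIV. f z) = (\<Sum>x\<in>UNIV. \<Sum>y\<in>UNIV. f (x, y))"
  by (simp add: sum_UNIV_prod)

lemma sum_UNIV_prod2:
  "(\<Sum>j\<in>UNIV. \<Sum>l\<in>UNIV. \<Sum>q\<in>UNIV. \<Sum>r\<in>UNIV. f j l q r) =
    (\<Sum>x\<in>UNIV. \<Sum>y\<in>UNIV. f (fst x) (snd x) (fst y) (snd y))"
  by (rule trans[OF sum_UNIV_prod], rule sum.cong[OF refl], rule sum_UNIV_prod)

lemma site_weight_expand:
  "site_weight e U a b c d = (\<Sum>j\<in>UNIV. \<Sum>q\<in>UNIV. e $ fst q * cnj (e $ snd q) *
     (cnj (U $ (fst a, fst b, fst q) $ (fst c, fst d, j)) * U $ (snd a, snd b, snd q) $ (snd c, snd d, j)))"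
  unfolding site_weight_def site_tensor_def cnj_sum sum_product sum_UNIV_prod
  by (simp add: mult_ac)

text \<open>A pairing acts on all parts of a composite index alike. This yields the product form
  that \<open>tnet_spin_sum\<close> expects of a site.\<close>

lemma matching_Times:
  "matching s (((a', b', i'), (a, b, i)), ((c', d', j'), (c, d, j))) =
    matching s ((a', a), (c', c)) * matching s ((b', b), (d', d)) * matching s ((i', i), (j', j))"
  by (cases s) (simp_all add: matching_def conj_ac flip: of_bool_conj)

text \<open>Either pairing joins the two copies of \<open>e\<close> to the two conjugate copies and
  gives the fourth power of its norm.\<close>

lemma sum_unit_vector_matching:
  fixes e :: "complex^'p::finite"
  assumes "norm e = 1"
  shows "(\<Sum>y\<in>UNIV. e $ fst (fst y) * cnj (e $ snd (fst y)) * (e $ fst (snd y) * cnj (e $ snd (snd y))) *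
    matching s y) = 1"
proof -
  have norm: "(\<Sum>i\<in>UNIV. e $ i * cnj (e $ i)) = 1"
  proof -
    have "(\<Sum>i\<in>UNIV. (cmod (e $ i))\<^sup>2) = 1"
      using assms by (simp add: norm_vec_def L2_set_def)
    then have "complex_of_real (\<Sum>i\<in>UNIV. (cmod (e $ i))\<^sup>2) = 1" by simp
    then show ?thesis unfolding of_real_sum complex_norm_square .
  qed
  have "(\<Sum>y\<in>UNIV. e $ fst (fst y) * cnj (e $ snd (fst y)) * (e $ fst (snd y) * cnj (e $ snd (snd y))) * matching s y) =
    (\<Sum>i'\<in>UNIV. \<Sum>i\<in>UNIV. \<Sum>j'\<in>UNIV. \<Sum>j\<in>UNIV. e $ i' * cnj (e $ i) * (e $ j' * cnj (e $ j)) * matching s ((i', i), (j', j)))"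
    unfolding sum_prod_split by simp
  also have "\<dots> = (\<Sum>i\<in>UNIV. \<Sum>j\<in>UNIV. e $ i * cnj (e $ i) * (e $ j * cnj (e $ j)))"
  proof (cases s)
    case True
    have "(\<Sum>i\<in>UNIV. \<Sum>j'\<in>UNIV. \<Sum>j\<in>UNIV. e $ i' * cnj (e $ i) * (e $ j' * cnj (e $ j)) * matching True ((i', i), (j', j))) =
      (\<Sum>i\<in>UNIV. e $ i' * cnj (e $ i') * (e $ i * cnj (e $ i)))" for i'
    proof (rule sum.cong[OF refl])
      fix i
      have "(\<Sum>j'\<in>UNIV. \<Sum>j\<in>UNIV. e $ i' * cnj (e $ i) * (e $ j' * cnj (e $ j)) * matching True ((i', i), (j', j))) =
        (\<Sum>j'\<in>UNIV. if j' = i then (\<Sum>j\<in>UNIV. if j = i' then e $ i' * cnj (e $ i) * (e $ i * cnj (e $ i')) else 0) else 0)"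
        by (intro sum.cong refl) (auto simp: matching_def intro!: sum.cong sum.neutral)
      then show "(\<Sum>j'\<in>UNIV. \<Sum>j\<in>UNIV. e $ i' * cnj (e $ i) * (e $ j' * cnj (e $ j)) * matching True ((i', i), (j', j))) =
        e $ i' * cnj (e $ i') * (e $ i * cnj (e $ i))"
        by (simp add: mult_ac)
    qed
    then show ?thesis using True by simp
  next
    case False
    have "(\<Sum>i\<in>UNIV. \<Sum>j'\<in>UNIV. \<Sum>j\<in>UNIV. e $ i' * cnj (e $ i) * (e $ j' * cnj (e $ j)) * matching False ((i', i), (j', j))) =
      (\<Sum>i\<in>UNIV. if i = i' then (\<Sum>j'\<in>UNIV. \<Sum>j\<in>UNIV. if j = j' then e $ i' * cnj (e $ i') * (e $ j' * cnj (e $ j')) else 0) else 0)" for i'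
      by (intro sum.cong refl) (auto simp: matching_def intro!: sum.cong sum.neutral)
    then show ?thesis using False by simp
  qed
  also have "\<dots> = 1"
    unfolding sum_product[symmetric] norm by simp
  finally show ?thesis .
qed

text \<open>Gluing two pairings closes two loops if they agree and one otherwise; each loop carries
  a free index.\<close>

lemma sum_matching:
  "(\<Sum>x\<in>(UNIV :: (('i::finite \<times> 'i) \<times> ('i \<times> 'i)) set). matching s x * matching t x) =
    (if s = t then (of_nat CARD('i))\<^sup>2 else of_nat CARD('i))"
proof -
  let ?f = "\<lambda>s t (i :: 'i) j k l. matching s ((i, j), (k, l)) * matching t ((i, j), (k, l))"
  have "?f False False i j k l = (if l = k then if j = i then 1 else 0 else 0)" for i j k l
    by (simp add: matching_def)
  moreover have "?f True True i j k l = (if l = i then if k = j then 1 else 0 else 0)" for i j k l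
    by (auto simp: matching_def)
  moreover have "?f False True i j k l = (if l = i then if k = i then if j = i then 1 else 0 else 0 else 0)" for i j k l
    by (auto simp: matching_def)
  moreover have "?f True False i j k l = ?f False True i j k l" for i j k l
    by (rule mult.commute)
  ultimately show ?thesis
    unfolding sum_prod_split by (cases s; cases t) (simp_all add: power2_eq_square flip: sum_distrib_left)
qed

lemma sum_swap_pairs:
  "(\<Sum>x\<in>A. \<Sum>y\<in>B. \<Sum>s\<in>C. \<Sum>t\<in>D. f x y s t) = (\<Sum>s\<in>C. \<Sum>t\<in>D. \<Sum>x\<in>A. \<Sum>y\<in>B. f x y s t)"
proof -
  have "(\<Sum>x\<in>A. \<Sum>y\<in>B. \<Sum>s\<in>C. \<Sum>t\<in>D. f x y s t) = (\<Sum>x\<in>A. \<Sum>s\<in>C. \<Sum>y\<in>B. \<Sum>t\<in>D. f x y s t)"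
    by (rule sum.cong[OF refl], rule sum.swap)
  also have "\<dots> = (\<Sum>s\<in>C. \<Sum>x\<in>A. \<Sum>y\<in>B. \<Sum>t\<in>D. f x y s t)"
    by (rule sum.swap)
  also have "\<dots> = (\<Sum>s\<in>C. \<Sum>x\<in>A. \<Sum>t\<in>D. \<Sum>y\<in>B. f x y s t)"
    by (rule sum.cong[OF refl], rule sum.cong[OF refl], rule sum.swap)
  also have "\<dots> = (\<Sum>s\<in>C. \<Sum>t\<in>D. \<Sum>x\<in>A. \<Sum>y\<in>B. f x y s t)"
    by (rule sum.cong[OF refl], rule sum.swap)
  finally show ?thesis .
qed

lemma sum_factor_pairs:
  fixes k f g :: "_ \<Rightarrow> _ \<Rightarrow> 'c::comm_semiring_1"
  shows "(\<Sum>x\<in>A. \<Sum>y\<in>B. h y * (\<Sum>s\<in>C. \<Sum>t\<in>D. k s t * f s y * g t x)) =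
    (\<Sum>s\<in>C. \<Sum>t\<in>D. k s t * (\<Sum>y\<in>B. h y * f s y) * (\<Sum>x\<in>A. g t x))"
proof -
  have "(\<Sum>x\<in>A. \<Sum>y\<in>B. h y * (\<Sum>s\<in>C. \<Sum>t\<in>D. k s t * f s y * g t x)) =
    (\<Sum>s\<in>C. \<Sum>t\<in>D. \<Sum>x\<in>A. \<Sum>y\<in>B. h y * (k s t * f s y * g t x))"
    unfolding sum_distrib_left by (rule sum_swap_pairs)
  also have "\<dots> = (\<Sum>s\<in>C. \<Sum>t\<in>D. k s t * (\<Sum>y\<in>B. h y * f s y) * (\<Sum>x\<in>A. g t x))"
    by (intro sum.cong refl) (simp add: sum_distrib_left sum_distrib_right mult_ac, rule sum.swap)
  finally show ?thesis .
qed

text \<open>Bra and ket of each copy share their physical index, so the column pairing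
  \<open>t\<close> is glued to the identity pairing.\<close>

definition physical_loops :: "nat \<Rightarrow> bool \<Rightarrow> real" where
  "physical_loops d t = (if t then real d else (real d)\<^sup>2)"

locale haar_site = haar \<mu>
  for \<mu> :: "(complex^('b::finite \<times> 'b \<times> 'p::finite)^('b \<times> 'b \<times> 'p)) measure" +
  fixes e :: "complex^'p"
  assumes norm_e: "norm e = 1" and two_le_card: "2 \<le> CARD('b)" "2 \<le> CARD('p)"
begin

lemma card_index: "CARD('b \<times> 'b \<times> 'p) = (CARD('b))\<^sup>2 * CARD('p)"
  by (simp add: power2_eq_square)

lemma card_index_ge: "2 \<le> CARD('b \<times> 'b \<times> 'p)"
proof -
  have "2 * (1 * 1) \<le> CARD('b) * (CARD('b) * CARD('p))"
    using two_le_card by (intro mult_le_mono) auto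
  then show ?thesis by simp
qed

lemma integrable_site_weight: "integrable \<mu> (\<lambda>U. site_weight e U a b c d)"
  unfolding site_weight_expand
  by (intro Bochner_Integration.integrable_sum integrable_mult_right integrable_quadratic)

lemma site_weight_mult:
  "site_weight e U a b c d * site_weight e U a' b' c' d' = (\<Sum>x\<in>UNIV. \<Sum>y\<in>UNIV.
     e $ fst (fst y) * cnj (e $ snd (fst y)) * (e $ fst (snd y) * cnj (e $ snd (snd y))) *
     (cnj (U $ (fst a, fst b, fst (fst y)) $ (fst c, fst d, fst x)) *
        U $ (snd a, snd b, snd (fst y)) $ (snd c, snd d, fst x) *
      (cnj (U $ (fst a', fst b', fst (snd y)) $ (fst c', fst d', snd x)) *
        U $ (snd a', snd b', snd (snd y)) $ (snd c', snd d', snd x))))"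
  unfolding site_weight_expand sum_product sum_UNIV_prod2
  by (intro sum.cong refl) (simp only: mult_ac)

lemma integrable_site_weight_mult:
  "integrable \<mu> (\<lambda>U. site_weight e U a b c d * site_weight e U a' b' c' d')"
  unfolding site_weight_mult
  by (intro Bochner_Integration.integrable_sum integrable_mult_right integrable_quartic)

lemma integral_site_weight:
  "(\<integral>U. site_weight e U a b c d \<partial>\<mu>) =
    of_bool (fst a = snd a) * of_bool (fst b = snd b) *
      (of_bool (fst c = snd c) * of_bool (fst d = snd d) / (of_nat CARD('b))\<^sup>2)"
proof -
  have norm: "(\<Sum>q\<in>UNIV. e $ fst q * cnj (e $ snd q) * of_bool (fst q = snd q)) = 1"
  proof -
    have "(\<Sum>q\<in>UNIV. e $ fst q * cnj (e $ snd q) * of_bool (fst q = snd q)) =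
      (\<Sum>i\<in>UNIV. \<Sum>j\<in>UNIV. e $ i * cnj (e $ j) * of_bool (i = j))"
      unfolding sum_UNIV_prod ..
    also have "\<dots> = (\<Sum>i\<in>UNIV. e $ i * cnj (e $ i))"
      by (simp add: of_bool_def if_distrib[of "\<lambda>x. _ * x"] cong: if_cong)
    also have "\<dots> = complex_of_real (\<Sum>i\<in>UNIV. (cmod (e $ i))\<^sup>2)"
      unfolding of_real_sum complex_norm_square ..
    also have "\<dots> = 1" using norm_e by (simp add: norm_vec_def L2_set_def)
    finally show ?thesis .
  qed
  let ?z = "of_bool (fst a = snd a) * of_bool (fst b = snd b) *
      (of_bool (fst c = snd c) * of_bool (fst d = snd d)) / of_nat CARD('b \<times> 'b \<times> 'p) :: complex"
  have "(\<integral>U. site_weight e U a b c d \<partial>\<mu>) =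
    (\<Sum>j\<in>(UNIV :: 'p set). \<Sum>q\<in>UNIV. e $ fst q * cnj (e $ snd q) * (\<integral>U. cnj (U $ (fst a, fst b, fst q) $ (fst c, fst d, j)) *
        U $ (snd a, snd b, snd q) $ (snd c, snd d, j) \<partial>\<mu>))"
    unfolding site_weight_expand
    by (simp add: Bochner_Integration.integral_sum Bochner_Integration.integrable_sum integrable_quadratic)
  also have "\<dots> = (\<Sum>j\<in>(UNIV :: 'p set). \<Sum>q\<in>UNIV. e $ fst q * cnj (e $ snd q) * of_bool (fst q = snd q) * ?z)"
    unfolding first_moment[OF card_index_ge] by (intro sum.cong refl) (auto simp: of_bool_def)
  also have "\<dots> = of_nat CARD('p) * ?z"
    unfolding sum_distrib_right[symmetric] norm by simp
  also have "\<dots> = of_bool (fst a = snd a) * of_bool (fst b = snd b) *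
      (of_bool (fst c = snd c) * of_bool (fst d = snd d) / (of_nat CARD('b))\<^sup>2)"
    by (simp add: power2_eq_square)
  finally show ?thesis .
qed

text \<open>The row pairing \<open>s\<close> is seen by the bonds \<open>a\<close> and
  \<open>b\<close> and by the reference vector, the column pairing \<open>t\<close> by the bonds
  \<open>c\<close> and \<open>d\<close> and by the physical index. Keeping the sum over
  \<open>t\<close> inside leaves one spin per site.\<close>

lemma integral_site_weight_mult:
  "(\<integral>U. site_weight e U (fst a) (fst b) (fst c) (fst d) * site_weight e U (snd a) (snd b) (snd c) (snd d) \<partial>\<mu>) =
    (\<Sum>s\<in>UNIV. matching s a * matching s b *
      (\<Sum>t\<in>UNIV. of_real (weingarten (real CARD('b \<times> 'b \<times> 'p)) s t * physical_loops CARD('p) t) *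
        (matching t c * matching t d)))"
proof -
  let ?W = "\<lambda>s t. complex_of_real (weingarten (real CARD('b \<times> 'b \<times> 'p)) s t)"
  let ?E = "\<lambda>y. e $ fst (fst y) * cnj (e $ snd (fst y)) * (e $ fst (snd y) * cnj (e $ snd (snd y)))"
  let ?M = "\<lambda>x y. moment \<mu>
      (((fst (fst a), fst (fst b), fst (fst y)), (snd (fst a), snd (fst b), snd (fst y))),
       ((fst (snd a), fst (snd b), fst (snd y)), (snd (snd a), snd (snd b), snd (snd y))))
      (((fst (fst c), fst (fst d), fst x), (snd (fst c), snd (fst d), fst x)),
       ((fst (snd c), fst (snd d), snd x), (snd (snd c), snd (snd d), snd x)))"
  have M: "?M x y = (\<Sum>s\<in>UNIV. \<Sum>t\<in>UNIV. (matching s a * matching s b * ?W s t * matching t c * matching t d) *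
      matching s y * matching t ((fst x, fst x), (snd x, snd x)))" for x :: "'p \<times> 'p" and y :: "('p \<times> 'p) \<times> ('p \<times> 'p)"
    unfolding moment_eq_weingarten[OF card_index_ge] matching_Times by (simp add: mult_ac)
  have loops: "(\<Sum>x\<in>(UNIV :: ('p \<times> 'p) set). matching t ((fst x, fst x), (snd x, snd x))) =
      of_real (physical_loops CARD('p) t)" for t
    unfolding sum_UNIV_prod[symmetric, of "\<lambda>x y. matching t ((x, x), (y, y))"]
    by (cases t) (simp_all add: matching_parallel physical_loops_def power2_eq_square)
  have "(\<integral>U. site_weight e U (fst a) (fst b) (fst c) (fst d) * site_weight e U (snd a) (snd b) (snd c) (snd d) \<partial>\<mu>) =
    (\<Sum>x\<in>UNIV. \<Sum>y\<in>UNIV. ?E y * ?M x y)"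
    unfolding site_weight_mult moment_def prod.case
    by (simp add: Bochner_Integration.integral_sum Bochner_Integration.integrable_sum integrable_quartic)
  also have "\<dots> = (\<Sum>s\<in>UNIV. \<Sum>t\<in>UNIV. (matching s a * matching s b * ?W s t * matching t c * matching t d) *
      (\<Sum>y\<in>UNIV. ?E y * matching s y) * (\<Sum>x\<in>(UNIV :: ('p \<times> 'p) set). matching t ((fst x, fst x), (snd x, snd x))))"
    unfolding M by (rule sum_factor_pairs)
  also have "\<dots> = (\<Sum>s\<in>UNIV. matching s a * matching s b *
      (\<Sum>t\<in>UNIV. of_real (weingarten (real CARD('b \<times> 'b \<times> 'p)) s t * physical_loops CARD('p) t) *
        (matching t c * matching t d)))"
    unfolding sum_unit_vector_matching[OF norm_e] loops
    by (simp add: sum_distrib_left mult_ac)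
  finally show ?thesis .
qed

end

section \<open>Exponential concentration\<close>

definition bond_loops :: "nat \<Rightarrow> bool \<Rightarrow> bool \<Rightarrow> real" where
  "bond_loops D t s = (if t = s then (real D)\<^sup>2 else real D)"

text \<open>The column bonds of a site are row bonds of its right and lower neighbours, whose spins
  are \<open>b\<close> and \<open>c\<close>; each bond glues \<open>t\<close> to the spin at its
  other end.\<close>

definition spin_weight :: "nat \<Rightarrow> nat \<Rightarrow> bool \<Rightarrow> bool \<Rightarrow> bool \<Rightarrow> real" where
  "spin_weight D d s b c = (\<Sum>t\<in>UNIV. weingarten ((real D)\<^sup>2 * real d) s t * physical_loops d t *
     (bond_loops D t b * bond_loops D t c))"

text \<open>With n = \<open>x\<^sup>2 * y\<close>, \<open>N\<close> is \<open>n\<^sup>2 - 1\<close>.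
  If both neighbours are \<open>False\<close>, the loop factors form the \<open>False\<close> column
  of the Gram matrix of size n, which \<open>weingarten\<close> inverts; hence the values 1 and
  0.\<close>

lemma spin_weight_eq:
  fixes D d :: nat
  assumes "2 \<le> D" "2 \<le> d"
  defines "x \<equiv> real D" and "y \<equiv> real d"
  defines "N \<equiv> x ^ 4 * y\<^sup>2 - 1"
  shows "0 < N"
    and "spin_weight D d False False False = 1"
    and "spin_weight D d True False False = 0"
    and "b \<noteq> c \<Longrightarrow> spin_weight D d False b c = (x ^ 3 * y\<^sup>2 - x) / N"
    and "b \<noteq> c \<Longrightarrow> spin_weight D d True b c = (x ^ 3 * y - x * y) / N"
    and "spin_weight D d False True True = (x\<^sup>2 * y\<^sup>2 - x\<^sup>2) / N"
    and "spin_weight D d True True True = (x ^ 4 * y - y) / N"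
proof -
  have xy: "2 \<le> x" "2 \<le> y" using assms by simp_all
  have "2 ^ 4 * 2\<^sup>2 \<le> x ^ 4 * y\<^sup>2"
    using xy by (intro mult_mono power_mono) auto
  then show N: "0 < N" unfolding N_def by simp
  have W: "weingarten ((real D)\<^sup>2 * real d) s t = (if s = t then 1 / N else - 1 / (x\<^sup>2 * y * N))" for s t
    by (simp add: weingarten_def N_def x_def y_def power_mult_distrib flip: power_mult)
  have eq: "spin_weight D d False b c =
      (y\<^sup>2 * (bond_loops D False b * bond_loops D False c) - bond_loops D True b * bond_loops D True c / x\<^sup>2) / N"
    "spin_weight D d True b c =
      (y * (bond_loops D True b * bond_loops D True c) - y * (bond_loops D False b * bond_loops D False c) / x\<^sup>2) / N" for b c
    using xy N unfolding spin_weight_def W UNIV_bool physical_loops_def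
    by (simp_all add: y_def[symmetric] field_simps power2_eq_square)
  show "spin_weight D d False False False = 1" "spin_weight D d True False False = 0"
    "spin_weight D d False True True = (x\<^sup>2 * y\<^sup>2 - x\<^sup>2) / N"
    "spin_weight D d True True True = (x ^ 4 * y - y) / N"
    using xy N unfolding eq bond_loops_def x_def[symmetric]
    by (simp_all add: N_def field_simps eval_nat_numeral)
  show "spin_weight D d False b c = (x ^ 3 * y\<^sup>2 - x) / N"
    "spin_weight D d True b c = (x ^ 3 * y - x * y) / N" if "b \<noteq> c"
    using that xy N unfolding eq bond_loops_def x_def[symmetric]
    by (cases b; cases c; simp add: field_simps eval_nat_numeral)+
qed

lemma spin_model_spin_weight:
  assumes "2 \<le> D" "2 \<le> d" "2 \<le> L"
  shows "spin_model (spin_weight D d) L"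
proof
  define x y where "x = real D" and "y = real d"
  define N where "N = x ^ 4 * y\<^sup>2 - 1"
  note eq = spin_weight_eq[OF assms(1,2), folded x_def y_def, folded N_def]
  \<comment> \<open>Distances from the extreme case D = d = 2. In these variables the polynomials in
    both estimates below have only nonnegative coefficients.\<close>
  define p q where "p = x - 2" and "q = y - 2"
  have pq: "0 \<le> p" "0 \<le> q" "x = 2 + p" "y = 2 + q"
    using assms by (simp_all add: p_def q_def x_def y_def)
  have x: "1 \<le> x" "1 \<le> x\<^sup>2" "1 \<le> x ^ 4" "1 \<le> y" "1 \<le> y\<^sup>2"
    using pq by (auto intro: one_le_power)
  have "0 \<le> x * (x\<^sup>2 * y\<^sup>2 - 1)" "0 \<le> x * y * (x\<^sup>2 - 1)" "0 \<le> x\<^sup>2 * (y\<^sup>2 - 1)" "0 \<le> y * (x ^ 4 - 1)"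
    using x mult_mono[of 1 "x\<^sup>2" 1 "y\<^sup>2"] by auto
  then have pos: "0 \<le> x ^ 3 * y\<^sup>2 - x" "0 \<le> x ^ 3 * y - x * y" "0 \<le> x\<^sup>2 * y\<^sup>2 - x\<^sup>2" "0 \<le> x ^ 4 * y - y"
    by (simp_all add: algebra_simps eval_nat_numeral)
  show "0 \<le> spin_weight D d s b c" for s b c
    using eq(1-3,6,7) eq(4,5)[of True False] eq(4,5)[of False True] pos
    by (cases s; cases b; cases c) simp_all
  show "spin_weight D d False False False = 1" "spin_weight D d True False False = 0" by (fact eq)+
  \<comment> \<open>Expansion of the slack in the bound 5/4, cleared of denominators; the constant 3
    is its value at D = d = 2.\<close>
  have "0 \<le> 3 + 96 * q + 48 * q ^ 2 + 100 * p + 272 * (p * q) + 112 * (p * q ^ 2) + 192 * p ^ 2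
      + 288 * (p ^ 2 * q) + 96 * (p ^ 2 * q ^ 2) + 112 * p ^ 3 + 128 * (p ^ 3 * q) + 36 * (p ^ 3 * q ^ 2)
      + 20 * p ^ 4 + 20 * (p ^ 4 * q) + 5 * (p ^ 4 * q ^ 2)"
    using pq by (intro add_nonneg_nonneg mult_nonneg_nonneg zero_le_power) auto
  also have "\<dots> = 5 * N - 4 * (x ^ 3 * y\<^sup>2 - x) - 16 * (x ^ 3 * y - x * y)"
    unfolding N_def pq(3,4) by algebra
  finally have "((x ^ 3 * y\<^sup>2 - x) + 4 * (x ^ 3 * y - x * y)) / N \<le> 5 / 4"
    using eq(1) by (simp add: pos_divide_le_eq)
  then have "(x ^ 3 * y\<^sup>2 - x) / N + 4 * ((x ^ 3 * y - x * y) / N) \<le> 5 / 4"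
    unfolding add_divide_distrib by simp
  then show "spin_weight D d False b c + 4 * spin_weight D d True b c \<le> 5 / 4" if "b \<noteq> c" for b c
    using that eq(4,5) by simp
  have "0 \<le> 39 + 272 * q + 128 * q ^ 2 + 80 * p + 576 * (p * q) + 272 * (p * q ^ 2) + 84 * p ^ 2
      + 464 * (p ^ 2 * q) + 212 * (p ^ 2 * q ^ 2) + 32 * p ^ 3 + 160 * (p ^ 3 * q) + 72 * (p ^ 3 * q ^ 2)
      + 4 * p ^ 4 + 20 * (p ^ 4 * q) + 9 * (p ^ 4 * q ^ 2)"
    using pq by (intro add_nonneg_nonneg mult_nonneg_nonneg zero_le_power) auto
  also have "\<dots> = 9 * N - 4 * (x\<^sup>2 * y\<^sup>2 - x\<^sup>2) - 16 * (x ^ 4 * y - y)"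
    unfolding N_def pq(3,4) by algebra
  finally have "((x\<^sup>2 * y\<^sup>2 - x\<^sup>2) + 4 * (x ^ 4 * y - y)) / N \<le> 9 / 4"
    using eq(1) by (simp add: pos_divide_le_eq)
  then show "spin_weight D d False True True + 4 * spin_weight D d True True True \<le> 9 / 4"
    unfolding eq(6,7) add_divide_distrib by simp
qed (fact assms(3))

context haar_site
begin

abbreviation "squared_norm L U \<equiv> tnet (sites L) (right L) (down L) (\<lambda>v. site_weight e (U v))"

text \<open>A single copy admits only one pairing, so the spin type is \<open>unit\<close>. Each
  site contributes D * D from its two bond loops against 1 / D^2 from the first moment.\<close>

lemma expectation_squared_norm: "(\<integral>U. squared_norm L U \<partial>(\<Pi>\<^sub>M v\<in>sites L. \<mu>)) = 1"
proof -
  let ?i = "\<lambda>(_ :: unit) (a :: 'b \<times> 'b). of_bool (fst a = snd a) :: complex"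
  let ?K = "\<lambda>s c d. ?i s c * ?i s d / (of_nat CARD('b))\<^sup>2"
  have sum_i: "(\<Sum>c\<in>(UNIV :: ('b \<times> 'b) set). of_bool (fst c = snd c)) = (of_nat CARD('b) :: complex)"
  proof -
    have "(\<Sum>c\<in>(UNIV :: ('b \<times> 'b) set). of_bool (fst c = snd c) :: complex) =
      (\<Sum>x\<in>(UNIV :: 'b set). \<Sum>y\<in>UNIV. if y = x then 1 else 0)"
      unfolding sum_prod_split by (intro sum.cong refl) auto
    also have "\<dots> = of_nat CARD('b)" by simp
    finally show ?thesis .
  qed
  have loops: "(\<Sum>c\<in>UNIV. \<Sum>d\<in>UNIV. ?i s c * ?i t d * ?K u c d) = 1" for s t u :: unit
  proof -
    have "(\<Sum>c\<in>UNIV. \<Sum>d\<in>UNIV. ?i s c * ?i t d * ?K u c d) =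
      (\<Sum>c\<in>(UNIV :: ('b \<times> 'b) set). \<Sum>d\<in>(UNIV :: ('b \<times> 'b) set).
        of_bool (fst c = snd c) * of_bool (fst d = snd d) / (of_nat CARD('b))\<^sup>2)"
      by (intro sum.cong refl) auto
    also have "\<dots> = of_nat CARD('b) * of_nat CARD('b) / (of_nat CARD('b))\<^sup>2"
      unfolding sum_divide_distrib[symmetric] sum_product[symmetric] sum_i ..
    finally show ?thesis by (simp add: power2_eq_square)
  qed
  have "(\<integral>U. squared_norm L U \<partial>(\<Pi>\<^sub>M v\<in>sites L. \<mu>)) =
    tnet (sites L) (right L) (down L) (\<lambda>v a b c d. \<integral>U. site_weight e U a b c d \<partial>\<mu>)"
    using prob_space_axioms integrable_site_weight by (intro integral_tnet) auto
  also have "\<dots> = tnet (sites L) (right L) (down L) (\<lambda>v a b c d. \<Sum>s\<in>UNIV. ?i s a * ?i s b * ?K s c d)"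
    by (intro tnet_cong) (simp add: integral_site_weight)
  also have "\<dots> = (\<Sum>\<sigma>\<in>sites L \<rightarrow>\<^sub>E (UNIV :: unit set). \<Prod>v\<in>sites L. \<Sum>c\<in>UNIV. \<Sum>d\<in>UNIV.
      ?i (\<sigma> (right L v)) c * ?i (\<sigma> (down L v)) d * ?K (\<sigma> v) c d)"
    by (rule tnet_spin_sum) (simp_all add: bij_right bij_down)
  also have "\<dots> = 1"
    unfolding loops by (simp add: card_PiE)
  finally show ?thesis .
qed

lemma integrable_squared_norm: "integrable (\<Pi>\<^sub>M v\<in>sites L. \<mu>) (squared_norm L)"
  using prob_space_axioms integrable_site_weight by (intro integrable_tnet) auto

lemma squared_norm_mult:
  "squared_norm L U * squared_norm L U = tnet (sites L) (right L) (down L)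
    (\<lambda>v a b c d. site_weight e (U v) (fst a) (fst b) (fst c) (fst d) *
      site_weight e (U v) (snd a) (snd b) (snd c) (snd d))"
  by (rule tnet_mult[OF right_down_sites])

lemma integrable_squared_norm_mult:
  "integrable (\<Pi>\<^sub>M v\<in>sites L. \<mu>) (\<lambda>U. squared_norm L U * squared_norm L U)"
  unfolding squared_norm_mult
  using prob_space_axioms integrable_site_weight_mult
  by (intro integrable_tnet[where w = "\<lambda>U a b c d. site_weight e U (fst a) (fst b) (fst c) (fst d) *
      site_weight e U (snd a) (snd b) (snd c) (snd d)"]) auto

lemma expectation_squared_norm_mult:
  "(\<integral>U. squared_norm L U * squared_norm L U \<partial>(\<Pi>\<^sub>M v\<in>sites L. \<mu>)) =
    of_real (\<Sum>\<sigma>\<in>sites L \<rightarrow>\<^sub>E UNIV. \<Prod>v\<in>sites L.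
      spin_weight CARD('b) CARD('p) (\<sigma> v) (\<sigma> (right L v)) (\<sigma> (down L v)))"
proof -
  let ?n = "real CARD('b \<times> 'b \<times> 'p)"
  let ?K = "\<lambda>s (c :: ('b \<times> 'b) \<times> ('b \<times> 'b)) (d :: ('b \<times> 'b) \<times> ('b \<times> 'b)). \<Sum>t\<in>UNIV. of_real (weingarten ?n s t * physical_loops CARD('p) t) *
        (matching t c * matching t d)"
  have loops: "(\<Sum>c\<in>UNIV. \<Sum>d\<in>UNIV. matching b c * matching b' d * ?K s c d) =
      of_real (spin_weight CARD('b) CARD('p) s b b')" for s b b'
  proof -
    let ?S = "UNIV :: (('b \<times> 'b) \<times> ('b \<times> 'b)) set"
    let ?k = "\<lambda>t. complex_of_real (weingarten ?n s t * physical_loops CARD('p) t)"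
    have "(\<Sum>c\<in>?S. \<Sum>d\<in>?S. matching b c * matching b' d * ?K s c d) =
      (\<Sum>c\<in>?S. \<Sum>d\<in>?S. \<Sum>t\<in>UNIV. matching b c * matching b' d * (?k t * (matching t c * matching t d)))"
      by (simp only: sum_distrib_left)
    also have "\<dots> = (\<Sum>c\<in>?S. \<Sum>t\<in>UNIV. \<Sum>d\<in>?S. matching b c * matching b' d * (?k t * (matching t c * matching t d)))"
      by (rule sum.cong[OF refl], rule sum.swap)
    also have "\<dots> = (\<Sum>t\<in>UNIV. \<Sum>c\<in>?S. \<Sum>d\<in>?S. matching b c * matching b' d * (?k t * (matching t c * matching t d)))"
      by (rule sum.swap)
    also have "\<dots> = (\<Sum>t\<in>UNIV. of_real (weingarten ?n s t * physical_loops CARD('p) t) *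
        ((\<Sum>c\<in>?S. matching t c * matching b c) * (\<Sum>d\<in>?S. matching t d * matching b' d)))"
      unfolding sum_product by (intro sum.cong refl) (simp add: sum_distrib_left mult_ac)
    also have "\<dots> = of_real (spin_weight CARD('b) CARD('p) s b b')"
      unfolding sum_matching spin_weight_def of_real_sum
      by (intro sum.cong refl) (simp add: card_index bond_loops_def power2_eq_square mult_ac)
    finally show ?thesis .
  qed
  have "(\<integral>U. squared_norm L U * squared_norm L U \<partial>(\<Pi>\<^sub>M v\<in>sites L. \<mu>)) =
    tnet (sites L) (right L) (down L) (\<lambda>v a b c d. \<integral>U. site_weight e U (fst a) (fst b) (fst c) (fst d) *
      site_weight e U (snd a) (snd b) (snd c) (snd d) \<partial>\<mu>)"
    unfolding squared_norm_mult
    using prob_space_axioms integrable_site_weight_mult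
    by (intro integral_tnet[where w = "\<lambda>U a b c d. site_weight e U (fst a) (fst b) (fst c) (fst d) *
      site_weight e U (snd a) (snd b) (snd c) (snd d)"]) auto
  also have "\<dots> = (\<Sum>\<sigma>\<in>sites L \<rightarrow>\<^sub>E UNIV. \<Prod>v\<in>sites L. \<Sum>c\<in>UNIV. \<Sum>d\<in>UNIV.
      matching (\<sigma> (right L v)) c * matching (\<sigma> (down L v)) d * ?K (\<sigma> v) c d)"
    unfolding integral_site_weight_mult
    by (rule tnet_spin_sum) (simp_all add: bij_right bij_down)
  finally show ?thesis unfolding loops by simp
qed

lemma squared_norm_real: "squared_norm L U = of_real (Re (squared_norm L U))"
proof -
  have "Im (squared_norm L U) = 0"
    unfolding tensor_inner_eq_tnet[symmetric] tensor_inner_def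
    by (simp add: Im_sum)
  then show ?thesis by (simp add: complex_eq_iff)
qed

lemma concentration:
  assumes L: "2 \<le> L" and "0 < \<epsilon>"
  shows "\<P>(U in (\<Pi>\<^sub>M v \<in> sites L. \<mu>). cmod (squared_norm L U - 1) \<ge> \<epsilon>)
    \<le> 64 / 25 * 0.7 ^ L / \<epsilon>\<^sup>2"
proof -
  let ?M = "\<Pi>\<^sub>M v \<in> sites L. \<mu>" and ?X = "\<lambda>U. Re (squared_norm L U)"
  interpret M: prob_space ?M
    by (rule prob_space_PiM) (rule prob_space_axioms)
  interpret spin_model "spin_weight CARD('b) CARD('p)" L
    using two_le_card L by (rule spin_model_spin_weight)
  have sq: "complex_of_real ((?X U)\<^sup>2) = squared_norm L U * squared_norm L U" for U
    unfolding power2_eq_square of_real_mult squared_norm_real[symmetric] ..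
  have int: "integrable ?M ?X"
    using integrable_squared_norm by (rule integrable_Re)
  have int2: "integrable ?M (\<lambda>U. (?X U)\<^sup>2)"
    using integrable_Re[OF integrable_squared_norm_mult[of L]] unfolding sq[symmetric] by simp
  have E1: "M.expectation ?X = 1"
    using integral_Re[OF integrable_squared_norm, of L] expectation_squared_norm[of L] by simp
  have "complex_of_real (M.expectation (\<lambda>U. (?X U)\<^sup>2)) = (\<integral>U. squared_norm L U * squared_norm L U \<partial>?M)"
    unfolding sq[symmetric] by (rule integral_complex_of_real[symmetric])
  then have "M.expectation (\<lambda>U. (?X U)\<^sup>2) = (\<Sum>\<sigma>\<in>sites L \<rightarrow>\<^sub>E UNIV. \<Prod>v\<in>sites L.
      spin_weight CARD('b) CARD('p) (\<sigma> v) (\<sigma> (right L v)) (\<sigma> (down L v)))"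
    unfolding expectation_squared_norm_mult of_real_eq_iff .
  \<comment> \<open>Subtracting the squared mean 1 cancels the contribution of the
    all-\<open>False\<close> configuration in \<open>torus_sum_le\<close>.\<close>
  then have "M.variance ?X \<le> (25 / 64) ^ (L - 1) * (25 / 16) ^ L"
    using torus_sum_le M.variance_eq[OF int int2] E1 by simp
  \<comment> \<open>The prefactor 64/25 compensates for the exponent \<open>L - 1\<close>, and
    625/1024 is below 0.7.\<close>
  also have "\<dots> = 64 / 25 * (25 / 64 * (25 / 16)) ^ L"
    using L by (cases L) (simp_all flip: power_mult_distrib)
  also have "\<dots> \<le> 64 / 25 * 0.7 ^ L"
    by (intro mult_left_mono power_mono) auto
  finally have var: "M.variance ?X \<le> 64 / 25 * 0.7 ^ L" .
  have cmod_eq: "cmod (squared_norm L U - 1) = \<bar>?X U - 1\<bar>" for U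
    by (subst squared_norm_real) (metis norm_of_real of_real_1 of_real_diff)
  have "M.prob {U \<in> space ?M. cmod (squared_norm L U - 1) \<ge> \<epsilon>} \<le> M.variance ?X / \<epsilon>\<^sup>2"
    using M.Chebyshev_inequality[OF borel_measurable_integrable[OF int] int2 \<open>0 < \<epsilon>\<close>]
    unfolding E1 cmod_eq .
  also have "\<dots> \<le> 64 / 25 * 0.7 ^ L / \<epsilon>\<^sup>2"
    using var by (rule divide_right_mono) simp
  finally show ?thesis .
qed

end

theorem theorem1:
  fixes e :: "complex^'p::finite"
    and \<mu> :: "(complex^('b::finite \<times> 'b \<times> 'p)^('b \<times> 'b \<times> 'p)) measure"
  assumes "CARD('b) \<ge> 2" and "CARD('p) \<ge> 2"
    and "norm e = 1"
    and "haar_unitary \<mu>"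
  shows "\<exists>C::real. \<forall>L\<ge>2. \<forall>\<epsilon>>0.
           \<P>(U in (\<Pi>\<^sub>M v \<in> sites L. \<mu>).
              cmod (tensor_inner L (tn_state L e U) (tn_state L e U) - 1) \<ge> \<epsilon>)
           \<le> C * 0.7 ^ L / \<epsilon>\<^sup>2"
proof -
  interpret haar_site \<mu> e
    using assms by unfold_locales auto
  show ?thesis
    unfolding tensor_inner_eq_tnet by (intro exI[of _ "64 / 25"] allI impI concentration)
qed

end
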